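(* Consider a distributed storage system (DSS) that uses an $[n,k]$ Reed-Solomon (RS) code $\mathscr{C}$ over $\mathbb{F}_q$ to store $f$ messages over $n$ noncolluding databases using Lagrange encoding. Let $\mu\in\{f,f+1,\ldots,\mu_g(f)\}$ be the number of candidate polynomial function evaluations of degree at most $g$, including the $f$ independent messages. Let $\tilde k=\min\{g(k-1)+1,n\}$. Then the private polynomial computation (PPC) rate $$\mathsf{R}_{\mathrm{PPC}}=\begin{cases}\dfrac{1}{f}\,\mathsf{H}_{\min}&\text{if }n\le g(k-1)+1,\\[2ex]\dfrac{\frac{k}{\tilde k}\left(1-\frac{\tilde k}{n}\right)\mathsf{H}_{\min}}{1-\left(\frac{\tilde k}{n}\right)^{\min\{\mu,\mathsf{M}_g(f)\}}-\left(\min\{\mu,\mathsf{M}_g(f)\}-f\right)\left(1-\frac{\tilde k}{n}\right)\left(\frac{\tilde k}{n}\right)^{\mu-1}}&\text{otherwise}\end{cases}$$ is achievable.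
   Context: Notation: $[a]=\{1,\ldots,a\}$; entropies $H$ are in $q$-ary units. $\mathsf{M}_g(f)=\binom{g+f}{g}-1$ is the number of monomials in $f$ variables of degree between $1$ and $g$, and $\mu_g(f)=\frac{q^{\mathsf{M}_g(f)}-1}{q-1}$ is the number of polynomials that are linear combinations over $\mathbb{F}_q$ of these monomials with nonzero coefficient vectors, counted up to scalar multiples. Lagrange encoding: let $\alpha_1,\ldots,\alpha_n\in\mathbb{F}_q$ be distinct and $\gamma_1,\ldots,\gamma_k\in\mathbb{F}_q$ be distinct ($q\ge n\ge k$). The $[n,k]$ RS code is $\{(\phi(\alpha_1),\ldots,\phi(\alpha_n)):\phi\in\mathbb{F}_q[z],\deg\phi<k\}$; a vector $(w_1,\ldots,w_k)\in\mathbb{F}_q^k$ is encoded as $(\ell(\alpha_1),\ldots,\ell(\alpha_n))$, where $\ell$ is the unique polynomial of degree at most $k-1$ with $\ell(\gamma_i)=w_i$ for all $i\in[k]$. Storage: there are $f$ independent messages $\mathbf{W}^{(1)},\ldots,\mathbf{W}^{(f)}$; each $\mathbf{W}^{(m)}$ is a random $\beta\times k$ matrix with entries i.i.d. uniform over $\mathbb{F}_q$, also written as a vector $(W^{(m)}_1,\ldots,W^{(m)}_{\mathsf{L}})$ with $\mathsf{L}=\beta k$. Each row $\mathbf{W}^{(m)}_i$ is Lagrange-encoded into $(C^{(m)}_{i,1},\ldots,C^{(m)}_{i,n})$. Database $j\in[n]$ stores $\mathbf{C}_j=(C^{(m)}_{i,j})_{i\in[\beta],m\in[f]}$. The parameter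 $\beta$ may be chosen by the scheme. Candidate functions: $\phi^{(1)},\ldots,\phi^{(\mu)}$ are polynomials in $f$ variables over $\mathbb{F}_q$ that are linear combinations of monomials of degree between $1$ and $g$ with pairwise nonproportional nonzero coefficient vectors, and the coordinate polynomials $z_1,\ldots,z_f$ (the $f$ messages) are among them. Put $X^{(v)}_l=\phi^{(v)}(W^{(1)}_l,\ldots,W^{(f)}_l)$ for $l\in[\mathsf{L}]$, $\mathbf{X}^{(v)}=(X^{(v)}_1,\ldots,X^{(v)}_{\mathsf{L}})$, $\mathbf{X}^{[\mu]}=(\mathbf{X}^{(1)},\ldots,\mathbf{X}^{(\mu)})$, and $\mathsf{H}_{\min}=\min_{v\in[\mu]}H(X^{(v)}_l)$ (independent of $l$). PPC protocol: for each desired index $v\in[\mu]$ the user sends a (random) query $Q^{(v)}_j$, generated independently of the messages, to each database $j\in[n]$. Database $j$ returns an answer $A^{(v)}_j$ (a string of symbols of $\mathbb{F}_q$) that is a deterministic function of $Q^{(v)}_j$ and $\mathbf{C}_j$. The protocol must satisfy, for all $v\ne v'$ in $[\mu]$ and $j\in[n]$: (privacy) $(Q^{(v)}_j,A^{(v)}_j,\mathbf{X}^{[\mu]})$ and $(Q^{(v')}_j,A^{(v')}_j,\mathbf{X}^{[\mu]})$ are identically distributed; (recovery) $H(\mathbf{X}^{(v)}\mid A^{(v)}_1,\ldots,A^{(v)}_n,Q^{(v)}_1,\ldots,Q^{(v)}_n)=0$. Rate: the rate of a protocol is $\mathsf{L}\mathsf{H}_{\min}/\mathsf{D}$, where $\mathsf{D}$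 is the total download cost, i.e. the total number of symbols of $\mathbb{F}_q$ downloaded from all databases. A rate is achievable if there is a PPC protocol attaining it for some $\beta$. *)

theory Defs
  imports
    "HOL-Probability.Probability"
    "HOL-Computational_Algebra.Polynomial"
    "HOL-Library.Poly_Mapping"
begin

(* All index sets [a] = {1,...,a} are rendered as {..<a}. *)

section \<open>Polynomials in several variables\<close>

(* Exponent vectors with finite support as keys, coefficients as values. *)
type_synonym 'a mpoly = "(nat \<Rightarrow>\<^sub>0 nat) \<Rightarrow>\<^sub>0 'a"

definition monom_degree :: "(nat \<Rightarrow>\<^sub>0 nat) \<Rightarrow> nat" where
  "monom_degree m = (\<Sum>i\<in>Poly_Mapping.keys m. Poly_Mapping.lookup m i)"

definition eval_monom :: "(nat \<Rightarrow> 'a::comm_semiring_1) \<Rightarrow> (nat \<Rightarrow>\<^sub>0 nat) \<Rightarrow> 'a" where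
  "eval_monom x m = (\<Prod>i\<in>Poly_Mapping.keys m. x i ^ Poly_Mapping.lookup m i)"

definition eval_mpoly :: "'a::comm_semiring_1 mpoly \<Rightarrow> (nat \<Rightarrow> 'a) \<Rightarrow> 'a" where
  "eval_mpoly p x = (\<Sum>m\<in>Poly_Mapping.keys p. Poly_Mapping.lookup p m * eval_monom x m)"

definition var_mpoly :: "nat \<Rightarrow> 'a::comm_semiring_1 mpoly" where
  "var_mpoly i = Poly_Mapping.single (Poly_Mapping.single i 1) 1"

definition num_monoms :: "nat \<Rightarrow> nat \<Rightarrow> nat" where
  "num_monoms g f = ((g + f) choose g) - 1"

(* The division is exact. *)
definition num_polys :: "nat \<Rightarrow> nat \<Rightarrow> nat \<Rightarrow> nat" where
  "num_polys q g f = (q ^ num_monoms g f - 1) div (q - 1)"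

definition candidate_functions ::
  "nat \<Rightarrow> nat \<Rightarrow> nat \<Rightarrow> (nat \<Rightarrow> 'a::field mpoly) \<Rightarrow> bool" where
  "candidate_functions g f \<mu> \<phi> \<longleftrightarrow>
     (\<forall>v<\<mu>. \<phi> v \<noteq> 0 \<and>
        (\<forall>m\<in>Poly_Mapping.keys (\<phi> v).
           Poly_Mapping.keys m \<subseteq> {..<f} \<and> 1 \<le> monom_degree m \<and> monom_degree m \<le> g)) \<and>
     (\<forall>v<\<mu>. \<forall>v'<\<mu>. v \<noteq> v' \<longrightarrow>
        \<not> (\<exists>c. \<forall>m. Poly_Mapping.lookup (\<phi> v) m = c * Poly_Mapping.lookup (\<phi> v') m)) \<and>
     (\<forall>i<f. \<exists>v<\<mu>. \<phi> v = var_mpoly i)"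

section \<open>Reed-Solomon coded storage with Lagrange encoding\<close>

definition lagrange_poly :: "nat \<Rightarrow> (nat \<Rightarrow> 'a::field) \<Rightarrow> (nat \<Rightarrow> 'a) \<Rightarrow> 'a poly" where
  "lagrange_poly k \<gamma> w = (THE p. degree p \<le> k - 1 \<and> (\<forall>c<k. poly p (\<gamma> c) = w c))"

(* The code symbol at coordinate j; j ranges over the n coordinates of the RS code. *)
definition lagrange_encode ::
  "nat \<Rightarrow> (nat \<Rightarrow> 'a::field) \<Rightarrow> (nat \<Rightarrow> 'a) \<Rightarrow> (nat \<Rightarrow> 'a) \<Rightarrow> nat \<Rightarrow> 'a" where
  "lagrange_encode k \<alpha> \<gamma> w j = poly (lagrange_poly k \<gamma> w) (\<alpha> j)"

(* W (m, i, c) is the entry in row i and column c of the m-th message. *)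
type_synonym 'a messages = "nat \<times> nat \<times> nat \<Rightarrow> 'a"

definition message_pmf :: "nat \<Rightarrow> nat \<Rightarrow> nat \<Rightarrow> 'a::{finite,field} messages pmf" where
  "message_pmf f \<beta> k =
     Pi_pmf ({..<f} \<times> {..<\<beta>} \<times> {..<k}) 0 (\<lambda>_. pmf_of_set UNIV)"

(* The content C_j of database j: the code symbols indexed by message and row. *)
definition stored ::
  "nat \<Rightarrow> nat \<Rightarrow> nat \<Rightarrow> (nat \<Rightarrow> 'a::field) \<Rightarrow> (nat \<Rightarrow> 'a) \<Rightarrow> 'a messages \<Rightarrow> nat \<Rightarrow> (nat \<times> nat \<Rightarrow> 'a)"
where
  "stored f \<beta> k \<alpha> \<gamma> W j =
     (\<lambda>(m, i)\<in>{..<f} \<times> {..<\<beta>}. lagrange_encode k \<alpha> \<gamma> (\<lambda>c. W (m, i, c)) j)"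

(* The vector form of a message lists its matrix entries row by row. *)
definition message_symbol :: "nat \<Rightarrow> 'a messages \<Rightarrow> nat \<Rightarrow> nat \<Rightarrow> 'a" where
  "message_symbol k W l m = W (m, l div k, l mod k)"

definition function_evals ::
  "nat \<Rightarrow> nat \<Rightarrow> 'a::comm_semiring_1 mpoly \<Rightarrow> 'a messages \<Rightarrow> 'a list" where
  "function_evals \<beta> k p W = map (\<lambda>l. eval_mpoly p (message_symbol k W l)) [0..<\<beta> * k]"

definition all_function_evals ::
  "nat \<Rightarrow> nat \<Rightarrow> nat \<Rightarrow> (nat \<Rightarrow> 'a::comm_semiring_1 mpoly) \<Rightarrow> 'a messages \<Rightarrow> 'a list list" where
  "all_function_evals \<beta> k \<mu> \<phi> W = map (\<lambda>v. function_evals \<beta> k (\<phi> v) W) [0..<\<mu>]"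

section \<open>Entropies\<close>

(* Entropies are in q-ary units. The law of X_l does not depend on l, so it is computed
   from f independent uniform symbols. *)
definition function_entropy :: "nat \<Rightarrow> 'a::{finite,field} mpoly \<Rightarrow> real" where
  "function_entropy f p =
     prob_space.entropy (measure_pmf (Pi_pmf {..<f} 0 (\<lambda>_. pmf_of_set (UNIV :: 'a set))))
       (real CARD('a)) (count_space UNIV) (eval_mpoly p)"

definition H_min :: "nat \<Rightarrow> nat \<Rightarrow> (nat \<Rightarrow> 'a::{finite,field} mpoly) \<Rightarrow> real" where
  "H_min f \<mu> \<phi> = Min ((\<lambda>v. function_entropy f (\<phi> v)) ` {..<\<mu>})"

section \<open>Private polynomial computation\<close>

(* Q v is the joint law of the queries sent to the databases when v is the desired index;
   only the components j < n matter. The answer function of database j does not see v.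
   The product measure expresses that queries are independent of the messages. *)
type_synonym 'q queries = "nat \<Rightarrow> (nat \<Rightarrow> 'q) pmf"
type_synonym ('a, 'q) answers = "nat \<Rightarrow> 'q \<Rightarrow> (nat \<times> nat \<Rightarrow> 'a) \<Rightarrow> 'a list"

definition ppc_space ::
  "nat \<Rightarrow> nat \<Rightarrow> nat \<Rightarrow> 'q queries \<Rightarrow> nat \<Rightarrow> ((nat \<Rightarrow> 'q) \<times> 'a::{finite,field} messages) pmf" where
  "ppc_space f \<beta> k Q v = pair_pmf (Q v) (message_pmf f \<beta> k)"

definition answer ::
  "nat \<Rightarrow> nat \<Rightarrow> nat \<Rightarrow> (nat \<Rightarrow> 'a::field) \<Rightarrow> (nat \<Rightarrow> 'a) \<Rightarrow> ('a, 'q) answers \<Rightarrow>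
   (nat \<Rightarrow> 'q) \<times> 'a messages \<Rightarrow> nat \<Rightarrow> 'a list" where
  "answer f \<beta> k \<alpha> \<gamma> A = (\<lambda>(q, W) j. A j (q j) (stored f \<beta> k \<alpha> \<gamma> W j))"

definition ppc_privacy ::
  "nat \<Rightarrow> nat \<Rightarrow> nat \<Rightarrow> nat \<Rightarrow> nat \<Rightarrow> (nat \<Rightarrow> 'a::{finite,field}) \<Rightarrow> (nat \<Rightarrow> 'a) \<Rightarrow>
   (nat \<Rightarrow> 'a mpoly) \<Rightarrow> 'q queries \<Rightarrow> ('a, 'q) answers \<Rightarrow> bool" where
  "ppc_privacy n k f \<mu> \<beta> \<alpha> \<gamma> \<phi> Q A \<longleftrightarrow>
     (\<forall>v<\<mu>. \<forall>v'<\<mu>. v \<noteq> v' \<longrightarrow> (\<forall>j<n.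
        let view = (\<lambda>(q, W). (q j, answer f \<beta> k \<alpha> \<gamma> A (q, W) j, all_function_evals \<beta> k \<mu> \<phi> W))
        in map_pmf view (ppc_space f \<beta> k Q v) = map_pmf view (ppc_space f \<beta> k Q v')))"

definition ppc_recovery ::
  "nat \<Rightarrow> nat \<Rightarrow> nat \<Rightarrow> nat \<Rightarrow> nat \<Rightarrow> (nat \<Rightarrow> 'a::{finite,field}) \<Rightarrow> (nat \<Rightarrow> 'a) \<Rightarrow>
   (nat \<Rightarrow> 'a mpoly) \<Rightarrow> 'q queries \<Rightarrow> ('a, 'q) answers \<Rightarrow> bool" where
  "ppc_recovery n k f \<mu> \<beta> \<alpha> \<gamma> \<phi> Q A \<longleftrightarrow>
     (\<forall>v<\<mu>. prob_space.conditional_entropy (measure_pmf (ppc_space f \<beta> k Q v))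
        (real CARD('a)) (count_space UNIV) (count_space UNIV)
        (\<lambda>(q, W). function_evals \<beta> k (\<phi> v) W)
        (\<lambda>(q, W). (map (answer f \<beta> k \<alpha> \<gamma> A (q, W)) [0..<n], map q [0..<n])) = 0)"

(* D is the number of downloaded symbols for every desired index and every realisation
   of the queries and messages. *)
definition ppc_download ::
  "nat \<Rightarrow> nat \<Rightarrow> nat \<Rightarrow> nat \<Rightarrow> nat \<Rightarrow> (nat \<Rightarrow> 'a::{finite,field}) \<Rightarrow> (nat \<Rightarrow> 'a) \<Rightarrow>
   'q queries \<Rightarrow> ('a, 'q) answers \<Rightarrow> nat \<Rightarrow> bool" where
  "ppc_download n k f \<mu> \<beta> \<alpha> \<gamma> Q A D \<longleftrightarrow>
     (\<forall>v<\<mu>. \<forall>\<omega>\<in>set_pmf (ppc_space f \<beta> k Q v).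
        (\<Sum>j<n. length (answer f \<beta> k \<alpha> \<gamma> A \<omega> j)) = D)"

(* Queries are discrete, hence without loss of generality encoded as natural numbers;
   count_space UNIV is then sigma-finite on the observations in the recovery condition. *)
definition ppc_achievable ::
  "nat \<Rightarrow> nat \<Rightarrow> nat \<Rightarrow> nat \<Rightarrow> (nat \<Rightarrow> 'a::{finite,field}) \<Rightarrow> (nat \<Rightarrow> 'a) \<Rightarrow>
   (nat \<Rightarrow> 'a mpoly) \<Rightarrow> real \<Rightarrow> bool" where
  "ppc_achievable n k f \<mu> \<alpha> \<gamma> \<phi> R \<longleftrightarrow>
     (\<exists>\<beta> (Q :: nat queries) A D. \<beta> \<ge> 1 \<and> D > 0 \<and>
        ppc_privacy n k f \<mu> \<beta> \<alpha> \<gamma> \<phi> Q A \<and>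
        ppc_recovery n k f \<mu> \<beta> \<alpha> \<gamma> \<phi> Q A \<and>
        ppc_download n k f \<mu> \<beta> \<alpha> \<gamma> Q A D \<and>
        R = real (\<beta> * k) * H_min f \<mu> \<phi> / real D)"

definition ppc_rate :: "nat \<Rightarrow> nat \<Rightarrow> nat \<Rightarrow> nat \<Rightarrow> nat \<Rightarrow> real \<Rightarrow> real" where
  "ppc_rate n k f g \<mu> h =
     (if n \<le> g * (k - 1) + 1 then 1 / real f * h
      else
        let k' = real (min (g * (k - 1) + 1) n);
            r = min \<mu> (num_monoms g f);
            \<rho> = k' / real n
        in (real k / k' * (1 - \<rho>) * h) /
           (1 - \<rho> ^ r - (real r - real f) * (1 - \<rho>) * \<rho> ^ (\<mu> - 1)))"

end

theory Submission
  imports Defs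
begin

text \<open>If n is at most g(k - 1) + 1, the messages are downloaded from k databases. Otherwise let
  K = g(k - 1) + 1 < n. Applying a candidate function to the stored symbols of a row gives a codeword
  of the Reed-Solomon code of dimension K, so K databases determine it.

  A database is asked, for various orders t, for all sums over the t-subsets S of the candidates in which
  the summand u in S is, up to a sign and a random scalar, function u at the row attached to the set S - u.
  The rows attached to the sets without the desired index v form a group. Used at order t at K databases,
  the group reveals function v there, because the interference in the sums over S containing v is
  known from a group of order t - 1; the sums over the sets without v become known at K, hence at all,
  databases and serve as interference of order t + 1 at the n - K others. A uniformly random assignment
  of rows and scalars hides v. With the signs of the exterior algebra, the sums over sets that
  avoid a spanning subfamily B of the candidates follow from the remaining ones and need not be
  downloaded; at order 1 it suffices to download the f message symbols.\<close>

section \<open>Entropy, interpolation and spanning families\<close>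

lemma distributed_pmf:
  "distributed (measure_pmf p) (count_space UNIV) Z (\<lambda>z. ennreal (pmf (map_pmf Z p) z))"
  unfolding distributed_def
  by (simp add: measure_pmf_eq_density[of "map_pmf Z p", symmetric] map_pmf_rep_eq)

text \<open>On the support, the event \<open>X = x, Y = y\<close> agrees almost surely with
  \<open>Y = y\<close>, so the logarithm in the entropy sum is that of 1; off the support, the
  probability in front of it is 0. Countable types make the product of the two counting measures a
  counting measure again.\<close>

lemma conditional_entropy_determined:
  fixes X :: "'w \<Rightarrow> 'x::countable" and Y :: "'w \<Rightarrow> 'y::countable"
  assumes b: "1 < b"
    and det: "\<And>w w'. w \<in> set_pmf p \<Longrightarrow> w' \<in> set_pmf p \<Longrightarrow> Y w = Y w' \<Longrightarrow> X w = X w'"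
  shows "prob_space.conditional_entropy (measure_pmf p) b (count_space UNIV) (count_space UNIV) X Y = 0"
proof -
  interpret information_space "measure_pmf p" b
    by standard fact
  let ?XY = "\<lambda>w. (X w, Y w)"
  have prod: "count_space UNIV \<Otimes>\<^sub>M count_space UNIV = (count_space UNIV :: ('x \<times> 'y) measure)"
    by (subst pair_measure_countable) auto
  have zero: "pmf (map_pmf ?XY p) (x, y) *
      log b (pmf (map_pmf ?XY p) (x, y) / pmf (map_pmf Y p) y) = 0" for x y
  proof (cases "(x, y) \<in> set_pmf (map_pmf ?XY p)")
    case True
    then obtain w where w: "w \<in> set_pmf p" "X w = x" "Y w = y"
      by auto
    have "measure (measure_pmf p) (?XY -` {(x, y)}) = measure (measure_pmf p) (Y -` {y})"
    proof (intro measure_pmf.finite_measure_eq_AE)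
      have "w' \<in> ?XY -` {(x, y)} \<longleftrightarrow> w' \<in> Y -` {y}" if "w' \<in> set_pmf p" for w'
        using det[OF that w(1)] w(2,3) by auto
      then show "AE w' in measure_pmf p. w' \<in> ?XY -` {(x, y)} \<longleftrightarrow> w' \<in> Y -` {y}"
        by (simp add: AE_measure_pmf_iff)
    qed auto
    then have "pmf (map_pmf ?XY p) (x, y) = pmf (map_pmf Y p) y"
      by (simp add: pmf_map)
    then show ?thesis
      by simp
  next
    case False
    then show ?thesis
      by (metis mult_zero_left set_pmf_iff)
  qed
  have XY: "distributed (measure_pmf p) (count_space UNIV \<Otimes>\<^sub>M count_space UNIV) ?XY
      (\<lambda>z. ennreal (pmf (map_pmf ?XY p) z))"
    unfolding prod by (rule distributed_pmf)
  have "prob_space.conditional_entropy (measure_pmf p) b (count_space UNIV) (count_space UNIV) X Y =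
      - (\<integral>(x, y). pmf (map_pmf ?XY p) (x, y) *
          log b (pmf (map_pmf ?XY p) (x, y) / pmf (map_pmf Y p) y)
        \<partial>(count_space UNIV \<Otimes>\<^sub>M count_space UNIV))"
    by (subst conditional_entropy_generic_eq[OF sigma_finite_measure_count_space
          sigma_finite_measure_count_space distributed_pmf _ XY]) simp_all
  also have "\<dots> = 0"
    by (simp only: zero) (simp add: case_prod_unfold)
  finally show ?thesis .
qed

section \<open>Lagrange interpolation\<close>

lemma lagrange_poly_exists:
  fixes \<gamma> w :: "nat \<Rightarrow> 'a::field"
  assumes "inj_on \<gamma> {..<k}"
  shows "\<exists>p. degree p \<le> k - 1 \<and> (\<forall>c<k. poly p (\<gamma> c) = w c)"
proof -
  define l where "l c = (\<Prod>i\<in>{..<k} - {c}. [:- \<gamma> i, 1:])" for c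
  define p where "p = (\<Sum>c<k. smult (w c / poly (l c) (\<gamma> c)) (l c))"
  have nz: "poly (l c) (\<gamma> c) \<noteq> 0" if "c < k" for c
    using that assms by (auto simp: l_def poly_prod inj_on_def)
  have other: "poly (l c) (\<gamma> c') = 0" if "c' < k" "c' \<noteq> c" for c c'
    using that by (auto simp: l_def poly_prod)
  have "degree (l c) \<le> k - 1" if "c < k" for c
  proof -
    have "degree (l c) \<le> (\<Sum>i\<in>{..<k} - {c}. degree [:- \<gamma> i, 1:])"
      unfolding l_def by (rule order_trans[OF degree_prod_sum_le]) auto
    also have "\<dots> \<le> k - 1"
      using that by simp
    finally show ?thesis .
  qed
  then have "degree p \<le> k - 1"
    unfolding p_def by (intro degree_sum_le) (auto intro: order_trans[OF degree_smult_le])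
  moreover have "poly p (\<gamma> c) = w c" if "c < k" for c
  proof -
    have "poly p (\<gamma> c) = (\<Sum>c'<k. if c' = c then w c else 0)"
      unfolding p_def poly_sum using that nz other by (intro sum.cong) auto
    then show ?thesis
      using that by simp
  qed
  ultimately show ?thesis
    by blast
qed

lemma poly_eq_0_if_many_zeros:
  fixes p :: "'a::idom poly"
  assumes "degree p < K" "inj_on x {..<K}" "\<And>i. i < K \<Longrightarrow> poly p (x i) = 0"
  shows "p = 0"
proof (rule ccontr)
  assume p: "p \<noteq> 0"
  have "K = card (x ` {..<K})"
    using assms(2) by (simp add: card_image)
  also have "\<dots> \<le> card {z. poly p z = 0}"
    using assms(3) p by (intro card_mono poly_roots_finite) auto
  also have "\<dots> \<le> degree p"
    using p by (rule card_poly_roots_bound)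
  finally show False
    using assms(1) by simp
qed

text \<open>\<open>lagrange_poly\<close> is a definite description, so both facts rest on existence
  and uniqueness; two interpolants differ by a polynomial of degree below \<open>k\<close> with
  \<open>k\<close> zeros.\<close>

lemma lagrange_poly_props:
  fixes \<gamma> w :: "nat \<Rightarrow> 'a::field"
  assumes "inj_on \<gamma> {..<k}" "1 \<le> k"
  shows degree_lagrange_poly: "degree (lagrange_poly k \<gamma> w) \<le> k - 1"
    and poly_lagrange_poly: "c < k \<Longrightarrow> poly (lagrange_poly k \<gamma> w) (\<gamma> c) = w c"
proof -
  have unique: "p = p'"
    if "degree p \<le> k - 1 \<and> (\<forall>c<k. poly p (\<gamma> c) = w c)"
      "degree p' \<le> k - 1 \<and> (\<forall>c<k. poly p' (\<gamma> c) = w c)" for p p'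
  proof -
    have "degree (p - p') < k"
      using that assms(2) degree_diff_le[of p "k - 1" p'] by simp
    then have "p - p' = 0"
      using that by (intro poly_eq_0_if_many_zeros[OF _ assms(1)]) auto
    then show ?thesis
      by simp
  qed
  have ex1: "\<exists>!p. degree p \<le> k - 1 \<and> (\<forall>c<k. poly p (\<gamma> c) = w c)"
    using lagrange_poly_exists[OF assms(1)] unique by blast
  from theI'[OF this]
  show "degree (lagrange_poly k \<gamma> w) \<le> k - 1"
    "c < k \<Longrightarrow> poly (lagrange_poly k \<gamma> w) (\<gamma> c) = w c"
    unfolding lagrange_poly_def by auto
qed

section \<open>Candidate functions along interpolation polynomials\<close>

text \<open>With \<open>L i\<close> the Lagrange polynomials of one row of the messages, the values
  at the \<open>\<gamma> c\<close> are the wanted evaluations, and the values at the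
  \<open>\<alpha> j\<close> are what database \<open>j\<close> obtains by applying \<open>p\<close>
  to its stored symbols.\<close>

definition compose_mpoly :: "'a::comm_ring_1 mpoly \<Rightarrow> (nat \<Rightarrow> 'a poly) \<Rightarrow> 'a poly" where
  "compose_mpoly p L = (\<Sum>m\<in>Poly_Mapping.keys p. smult (Poly_Mapping.lookup p m)
     (\<Prod>i\<in>Poly_Mapping.keys m. L i ^ Poly_Mapping.lookup m i))"

lemma poly_compose_mpoly: "poly (compose_mpoly p L) z = eval_mpoly p (\<lambda>i. poly (L i) z)"
  by (simp add: compose_mpoly_def eval_mpoly_def eval_monom_def poly_sum poly_prod)

lemma degree_compose_mpoly:
  assumes "\<And>i. degree (L i) \<le> d" "\<And>m. m \<in> Poly_Mapping.keys p \<Longrightarrow> monom_degree m \<le> g"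
  shows "degree (compose_mpoly p L) \<le> g * d"
  unfolding compose_mpoly_def
proof (intro degree_sum_le order_trans[OF degree_smult_le])
  fix m assume m: "m \<in> Poly_Mapping.keys p"
  have "degree (\<Prod>i\<in>Poly_Mapping.keys m. L i ^ Poly_Mapping.lookup m i)
      \<le> (\<Sum>i\<in>Poly_Mapping.keys m. degree (L i ^ Poly_Mapping.lookup m i))"
    by (rule order_trans[OF degree_prod_sum_le]) auto
  also have "\<dots> \<le> (\<Sum>i\<in>Poly_Mapping.keys m. Poly_Mapping.lookup m i * d)"
    using assms(1) 
    by (intro sum_mono order_trans[OF degree_power_le]) (simp add: mult.commute mult_le_mono2)
  also have "\<dots> = monom_degree m * d"
    by (simp add: monom_degree_def sum_distrib_right)
  also have "\<dots> \<le> g * d"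
    using assms(2)[OF m] by simp
  finally show "degree (\<Prod>i\<in>Poly_Mapping.keys m. L i ^ Poly_Mapping.lookup m i) \<le> g * d" .
qed auto

lemma eval_mpoly_cong:
  assumes "\<And>m i. m \<in> Poly_Mapping.keys p \<Longrightarrow> i \<in> Poly_Mapping.keys m \<Longrightarrow> x i = y i"
  shows "eval_mpoly p x = eval_mpoly p y"
  unfolding eval_mpoly_def eval_monom_def using assms by (intro sum.cong prod.cong arg_cong2[where f="(*)"]) auto

section \<open>Spanning subfamilies and the number of monomials\<close>

text \<open>Gaussian elimination, one column \<open>m\<close> at a time: a zero column is dropped;
  otherwise a pivot row \<open>p\<close> clears the column and the induction hypothesis is applied
  to the reduced rows.\<close>

lemma spanning_subfamily:
  fixes w :: "nat \<Rightarrow> 'm \<Rightarrow> 'a::field"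
  assumes "finite N" "finite I"
  shows "\<exists>B\<subseteq>I. card B \<le> card N \<and> (\<exists>a. \<forall>u\<in>I. \<forall>m\<in>N. w u m = (\<Sum>b\<in>B. a u b * w b m))"
  using assms(1)
proof (induction N arbitrary: w)
  case empty
  show ?case
    by (intro exI[of _ "{}"]) auto
next
  case (insert m N)
  show ?case
  proof (cases "\<forall>u\<in>I. w u m = 0")
    case True
    obtain B a where B: "B \<subseteq> I" "card B \<le> card N" 
      and "\<forall>u\<in>I. \<forall>m\<in>N. w u m = (\<Sum>b\<in>B. a u b * w b m)"
      using insert.IH[of w] by blast
    then have "\<forall>u\<in>I. \<forall>m'\<in>insert m N. w u m' = (\<Sum>b\<in>B. a u b * w b m')"
      using True by (auto simp: subset_iff)
    then show ?thesis
      using B insert.hyps by (intro exI[of _ B]) auto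
  next
    case False
    then obtain p where p: "p \<in> I" "w p m \<noteq> 0"
      by auto
    define c where "c u = w u m / w p m" for u
    obtain B a where B: "B \<subseteq> I" "card B \<le> card N" 
      and a: "\<forall>u\<in>I. \<forall>m\<in>N. w u m - c u * w p m = (\<Sum>b\<in>B. a u b * (w b m - c b * w p m))"
      using insert.IH[of "\<lambda>u m. w u m - c u * w p m"] by blast
    have fin: "finite B"
      using B(1) assms(2) by (rule finite_subset)
    \<comment> \<open>Back substitution: all multiples of the pivot row are collected in one
      coefficient. The pivot \<open>p\<close> may already belong to \<open>B\<close>, so the two
      contributions are added.\<close>
    define a' where
      "a' u b = (if b \<in> B then a u b else 0) + (if b = p then c u - (\<Sum>b\<in>B. a u b * c b) else 0)"
      for u b
    have "w u m' = (\<Sum>b\<in>insert p B. a' u b * w b m')" if "u \<in> I" "m' \<in> insert m N" for u m'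
    proof -
      have "w u m' - c u * w p m' = (\<Sum>b\<in>B. a u b * (w b m' - c b * w p m'))"
        using a that p by (auto simp: c_def)
      then have "w u m' = (\<Sum>b\<in>B. a u b * w b m') + (c u - (\<Sum>b\<in>B. a u b * c b)) * w p m'"
        by (simp add: algebra_simps sum_subtractf sum_distrib_left)
      also have "(\<Sum>b\<in>B. a u b * w b m') =
          (\<Sum>b\<in>insert p B. (if b \<in> B then a u b else 0) * w b m')"
        using fin by (intro sum.mono_neutral_cong_left) auto
      also have "(c u - (\<Sum>b\<in>B. a u b * c b)) * w p m' =
          (\<Sum>b\<in>insert p B. if b = p then (c u - (\<Sum>b\<in>B. a u b * c b)) * w b m' else 0)"
        using fin by simp
      finally show ?thesis
        by (simp add: a'_def distrib_right sum.distrib if_distrib[of "\<lambda>x. x * _"] cong: if_cong)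
    qed
    then have "\<exists>a. \<forall>u\<in>I. \<forall>m'\<in>insert m N. w u m' = (\<Sum>b\<in>insert p B. a u b * w b m')"
      by blast
    moreover have "card (insert p B) \<le> card (insert m N)"
      using B(2) insert.hyps fin by (simp add: card_insert_if)
    ultimately show ?thesis
      using B(1) p(1) by (intro exI[of _ "insert p B"] conjI) blast+
  qed
qed

definition monomials :: "nat \<Rightarrow> nat \<Rightarrow> (nat \<Rightarrow>\<^sub>0 nat) set" where
  "monomials g f = {m. Poly_Mapping.keys m \<subseteq> {..<f} \<and> 1 \<le> monom_degree m \<and> monom_degree m \<le> g}"

lemma monom_degree_eq_sum_list:
  assumes "Poly_Mapping.keys m \<subseteq> {..<f}"
  shows "monom_degree m = sum_list (map (Poly_Mapping.lookup m) [0..<f])"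
proof -
  have "monom_degree m = (\<Sum>i<f. Poly_Mapping.lookup m i)"
    unfolding monom_degree_def using assms
    by (intro sum.mono_neutral_left) (auto simp: in_keys_iff)
  then show ?thesis
    by (simp add: interv_sum_list_conv_sum_set_nat atLeast0LessThan)
qed

text \<open>Adding a slack entry turns the bound on the degree into an equation.\<close>

lemma card_monomials: "finite (monomials g f)" "card (monomials g f) \<le> num_monoms g f"
proof -
  let ?M = "{m. Poly_Mapping.keys m \<subseteq> {..<f} \<and> monom_degree m \<le> g}"
  let ?L = "{l::nat list. length l = f + 1 \<and> sum_list l = g}"
  let ?h = "\<lambda>m. (g - monom_degree m) # map (Poly_Mapping.lookup m) [0..<f]"
  have "inj_on ?h ?M"
  proof (rule inj_onI)
    fix m m' assume *: "m \<in> ?M" "m' \<in> ?M" "?h m = ?h m'"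
    have "Poly_Mapping.lookup m i = Poly_Mapping.lookup m' i" for i
    proof (cases "i < f")
      case True
      then show ?thesis
        using *(3) by auto
    next
      case False
      then have "i \<notin> Poly_Mapping.keys m" "i \<notin> Poly_Mapping.keys m'"
        using * by auto
      then show ?thesis
        by (simp add: in_keys_iff)
    qed
    then show "m = m'"
      by (rule poly_mapping_eqI)
  qed
  note inj = this
  have sub: "?h ` ?M \<subseteq> ?L"
    by (auto simp: monom_degree_eq_sum_list)
  have cardL: "card ?L = (g + f) choose g"
    using card_length_sum_list[of "f + 1" g] by simp
  have finL: "finite ?L"
    using cardL by (intro card_ge_0_finite) simp
  have finM: "finite ?M"
    using inj sub finL by (rule inj_on_finite)
  have cardM: "card ?M \<le> (g + f) choose g"
    using card_inj_on_le[OF inj sub finL] cardL by simp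
  \<comment> \<open>Dropping the constant monomial, of degree 0, yields the \<open>- 1\<close> in
    \<open>num_monoms\<close>.\<close>
  have "monomials g f \<subseteq> ?M - {0}"
    by (auto simp: monomials_def monom_degree_def)
  moreover have "0 \<in> ?M"
    by (simp add: monom_degree_def)
  ultimately have "card (monomials g f) \<le> card ?M - 1"
    using finM card_mono[of "?M - {0}" "monomials g f"] by simp
  then show "card (monomials g f) \<le> num_monoms g f"
    using cardM by (simp add: num_monoms_def)
  show "finite (monomials g f)"
    using finM by (rule finite_subset[rotated]) (auto simp: monomials_def)
qed

section \<open>Alternating sums\<close>

text \<open>The sign from sorting \<open>u\<close> into \<open>T\<close>: for basis vectors of an
  exterior algebra and \<open>u\<close> outside \<open>T\<close>, the wedge product of
  \<open>e u\<close> with the increasing product \<open>e T\<close> is \<open>asgn u T\<close> times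
  the increasing product over \<open>insert u T\<close>.\<close>

definition asgn :: "nat \<Rightarrow> nat set \<Rightarrow> 'a::comm_ring_1" where
  "asgn u T = (- 1) ^ card {w \<in> T. w < u}"

definition alt_sum :: "(nat \<Rightarrow> nat set \<Rightarrow> 'a::comm_ring_1) \<Rightarrow> nat set \<Rightarrow> 'a" where
  "alt_sum y S = (\<Sum>u\<in>S. asgn u (S - {u}) * y u (S - {u}))"

lemma asgn_empty [simp]: "asgn u {} = 1"
  by (simp add: asgn_def)

lemma asgn_insert:
  assumes "finite T" "x \<notin> T"
  shows "asgn u (insert x T) = (if x < u then - asgn u T else asgn u T)"
proof -
  have "{w \<in> insert x T. w < u} =
      (if x < u then insert x {w \<in> T. w < u} else {w \<in> T. w < u})"
    by auto
  then show ?thesis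
    using assms by (simp add: asgn_def)
qed

lemma asgn_square [simp]: "asgn u T * asgn u T = 1"
  by (simp add: asgn_def flip: power_add)

lemma asgn_square_left [simp]: "asgn u T * (asgn u T * x) = x"
  by (simp flip: mult.assoc)

lemma asgn_nonzero [simp]: "asgn u T \<noteq> (0 :: 'a::comm_ring_1)"
  by (metis asgn_square mult_zero_left zero_neq_one)

lemma poly_asgn [simp]: "poly (asgn u T) x = asgn u T"
  by (simp add: asgn_def)

lemma poly_alt_sum: "poly (alt_sum y S) x = alt_sum (\<lambda>u T. poly (y u T) x) S"
  by (simp add: alt_sum_def poly_sum)

lemma alt_sum_cong:
  assumes "\<And>u. u \<in> S \<Longrightarrow> y u (S - {u}) = y' u (S - {u})"
  shows "alt_sum y S = alt_sum y' S"
  using assms by (simp add: alt_sum_def)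

lemma alt_sum_insert:
  assumes "finite R" "v \<notin> R"
  shows "alt_sum y (insert v R) =
    asgn v R * y v R + (\<Sum>u\<in>R. asgn u (insert v (R - {u})) * y u (insert v (R - {u})))"
proof -
  have "insert v R - {u} = insert v (R - {u})" if "u \<in> R" for u
    using that assms(2) by auto
  then show ?thesis
    using assms by (simp add: alt_sum_def)
qed

lemma sum_off_diagonal_swap:
  assumes "finite S"
  shows "(\<Sum>u\<in>S. \<Sum>w\<in>S - {u}. F u w) = (\<Sum>w\<in>S. \<Sum>u\<in>S - {w}. F u w)"
proof -
  have "S - {u} = {w \<in> S. w \<noteq> u}" "S - {u} = {w \<in> S. u \<noteq> w}" for u
    by auto
  then show ?thesis
    using sum.swap_restrict[OF assms assms, of F "\<lambda>u w. w \<noteq> u"] by simp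
qed

text \<open>The pair \<open>(u, w)\<close> cancels against \<open>(w, u)\<close>. Matching
  \<open>w < u\<close> with \<open>u < w\<close>, instead of showing that the sum equals its
  negative, also covers characteristic 2.\<close>

lemma sum_off_diagonal_antisym:
  fixes F :: "nat \<Rightarrow> nat \<Rightarrow> 'a::ab_group_add"
  assumes "finite S" and anti: "\<And>u w. u \<in> S \<Longrightarrow> w \<in> S \<Longrightarrow> u < w \<Longrightarrow> F w u = - F u w"
  shows "(\<Sum>u\<in>S. \<Sum>w\<in>S - {u}. F u w) = 0"
proof -
  have split: "(\<Sum>w\<in>S - {u}. F u w) = (\<Sum>w | w \<in> S \<and> w < u. F u w) + (\<Sum>w | w \<in> S \<and> u < w. F u w)"
    for u
    using assms(1) by (subst sum.union_disjoint[symmetric]) (auto intro!: sum.cong)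
  have "(\<Sum>u\<in>S. \<Sum>w | w \<in> S \<and> w < u. F u w) = (\<Sum>w\<in>S. \<Sum>u | u \<in> S \<and> w < u. F u w)"
    by (rule sum.swap_restrict) fact+
  also have "\<dots> = - (\<Sum>w\<in>S. \<Sum>u | u \<in> S \<and> w < u. F w u)"
    using anti by (simp flip: sum_negf)
  finally show ?thesis
    by (simp add: split sum.distrib)
qed

text \<open>With y u the components of vectors of an exterior algebra, alt_sum y is the sum of the
  wedge products of basis vector u with y u. The lemma substitutes minus the sum of the
  vectors c w e w for the basis vector b.\<close>

lemma alt_sum_substitute:
  fixes y :: "nat \<Rightarrow> nat set \<Rightarrow> 'a::comm_ring_1" and c :: "nat \<Rightarrow> 'a"
  assumes fin: "finite S" and b: "b \<notin> S"
  defines "z \<equiv> \<lambda>u T. y u T -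
    (\<Sum>w\<in>T. c w * asgn w (T - {w}) * asgn b (T - {w}) * y u (insert b (T - {w})))"
  shows "alt_sum (\<lambda>u T. z u T - c u * z b T) S = alt_sum y S -
    (\<Sum>w\<in>S. c w * asgn w (S - {w}) * asgn b (S - {w}) * alt_sum y (insert b (S - {w})))"
proof -
  define R where "R u w = S - {u} - {w}" for u w
  \<comment> \<open>\<open>P\<close> collects the correction terms in \<open>z u\<close>, and
    \<open>Q\<close> those in \<open>z b\<close>. Exchanging \<open>u\<close> and \<open>w\<close>
    flips the sign of \<open>Q\<close>, so its double sum vanishes; \<open>P\<close> matches the
    sums over the sets containing \<open>b\<close>.\<close>
  define P where "P u w = asgn u (S - {u}) * c w * asgn w (R u w) * asgn b (R u w) *
    y u (insert b (R u w))" for u w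
  define Q where "Q u w = asgn u (S - {u}) * c u * c w * asgn w (R u w) * asgn b (R u w) *
    y b (insert b (R u w))" for u w
  have R_sym: "R u w = R w u" for u w
    by (auto simp: R_def)
  have S_minus: "S - {u} = insert w (R u w)" if "w \<in> S" "u \<in> S" "u \<noteq> w" for u w
    using that by (auto simp: R_def)
  have finR: "finite (R u w)" and R_mem: "u \<notin> R u w" "w \<notin> R u w" "b \<notin> R u w" for u w
    using fin b by (auto simp: R_def)
  have asgn_S: "asgn x (S - {u}) = (if w < x then - asgn x (R u w) else asgn x (R u w) :: 'a)"
    if "w \<in> S" "u \<in> S" "u \<noteq> w" for x u w
    by (simp add: S_minus[OF that] asgn_insert finR R_mem)
  have "(\<Sum>u\<in>S. \<Sum>w\<in>S - {u}. Q u w) = 0"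
  proof (rule sum_off_diagonal_antisym[OF fin])
    fix u w assume "u \<in> S" "w \<in> S" "u < w"
    then show "Q w u = - Q u w"
      using asgn_S[of w u] asgn_S[of u w] by (simp add: Q_def R_sym[of w u])
  qed
  have P_eq: "P u w = c w * asgn w (S - {w}) * asgn b (S - {w}) *
      (asgn u (insert b (R w u)) * y u (insert b (R w u)))"
    if "u \<in> S" "w \<in> S" "u \<noteq> w" for u w
    using that b asgn_S[of w u] asgn_S[of u w]
    by (auto simp: P_def R_sym[of w u] asgn_insert finR R_mem)
  have "(\<Sum>w\<in>S. c w * asgn w (S - {w}) * asgn b (S - {w}) * alt_sum y (insert b (S - {w}))) =
      (\<Sum>w\<in>S. c w * asgn w (S - {w}) * y b (S - {w})) + (\<Sum>w\<in>S. \<Sum>u\<in>S - {w}. P u w)"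
  proof -
    have "c w * asgn w (S - {w}) * asgn b (S - {w}) * alt_sum y (insert b (S - {w})) =
        c w * asgn w (S - {w}) * y b (S - {w}) + (\<Sum>u\<in>S - {w}. P u w)" if "w \<in> S" for w
    proof -
      have "(\<Sum>u\<in>S - {w}. P u w) = (\<Sum>u\<in>S - {w}. c w * asgn w (S - {w}) * asgn b (S - {w}) *
          (asgn u (insert b (R w u)) * y u (insert b (R w u))))"
        using that by (intro sum.cong P_eq) auto
      also have "\<dots> = c w * asgn w (S - {w}) * asgn b (S - {w}) *
          (\<Sum>u\<in>S - {w}. asgn u (insert b (R w u)) * y u (insert b (R w u)))"
        by (simp only: sum_distrib_left)
      finally show ?thesis
        using fin b by (simp add: alt_sum_insert R_def algebra_simps)
    qed
    then show ?thesis
      by (simp add: sum.distrib)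
  qed
  also have "(\<Sum>w\<in>S. \<Sum>u\<in>S - {w}. P u w) = (\<Sum>u\<in>S. \<Sum>w\<in>S - {u}. P u w)"
    using sum_off_diagonal_swap[OF fin, of P] by simp
  finally have rhs: "(\<Sum>w\<in>S. c w * asgn w (S - {w}) * asgn b (S - {w}) *
        alt_sum y (insert b (S - {w}))) =
      (\<Sum>w\<in>S. c w * asgn w (S - {w}) * y b (S - {w})) + (\<Sum>u\<in>S. \<Sum>w\<in>S - {u}. P u w)" .
  have "alt_sum (\<lambda>u T. z u T - c u * z b T) S =
      (\<Sum>u\<in>S. asgn u (S - {u}) * y u (S - {u}) - (\<Sum>w\<in>S - {u}. P u w) -
        c u * asgn u (S - {u}) * y b (S - {u}) + (\<Sum>w\<in>S - {u}. Q u w))"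
    unfolding alt_sum_def
    by (intro sum.cong)
      (simp_all add: z_def P_def Q_def R_def algebra_simps sum_distrib_left)
  also have "\<dots> = alt_sum y S - (\<Sum>u\<in>S. \<Sum>w\<in>S - {u}. P u w) -
      (\<Sum>u\<in>S. c u * asgn u (S - {u}) * y b (S - {u})) + (\<Sum>u\<in>S. \<Sum>w\<in>S - {u}. Q u w)"
    by (simp add: sum.distrib sum_subtractf alt_sum_def)
  finally show ?thesis
    using \<open>(\<Sum>u\<in>S. \<Sum>w\<in>S - {u}. Q u w) = 0\<close> rhs by simp
qed

text \<open>Induction on \<open>B\<close>. In the exterior algebra, the sum of \<open>e u\<close>
  wedge \<open>y u\<close> equals the sum over \<open>b\<close> in \<open>B\<close> of
  \<open>F b\<close> wedge \<open>y b\<close>, where \<open>F b\<close> is the sum of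
  \<open>a u b\<close> times \<open>e u\<close>. Replacing \<open>e b\<close> by minus the other
  terms of \<open>F b\<close> kills that summand and so removes \<open>b\<close> from
  \<open>B\<close>. By \<open>alt_sum_substitute\<close> it changes the coordinates at sets avoiding
  \<open>b\<close> only by sums over sets that contain \<open>b\<close>, which vanish by
  assumption.\<close>

lemma alt_sum_eq_0_if_meeting_spanning:
  fixes y :: "nat \<Rightarrow> nat set \<Rightarrow> 'a::comm_ring_1"
  assumes "finite B" "finite U" "B \<subseteq> U"
    and "\<And>b b'. b \<in> B \<Longrightarrow> b' \<in> B \<Longrightarrow> a b b' = (if b = b' then 1 else 0)"
    and "\<And>u T. u \<in> U \<Longrightarrow> T \<subseteq> U \<Longrightarrow> card T = t \<Longrightarrow> y u T = (\<Sum>b\<in>B. a u b * y b T)"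
    and "\<And>S. S \<subseteq> U \<Longrightarrow> card S = Suc t \<Longrightarrow> S \<inter> B \<noteq> {} \<Longrightarrow> alt_sum y S = 0"
    and "S \<subseteq> U" "card S = Suc t"
  shows "alt_sum y S = 0"
  using assms
proof (induction B arbitrary: U y S rule: finite_induct)
  case empty
  have "finite S"
    using empty.prems by (metis finite_subset)
  have "y u (S - {u}) = 0" if "u \<in> S" for u
    using empty.prems(4)[of u "S - {u}"] empty.prems(6,7) that \<open>finite S\<close> by auto
  then show ?case
    by (simp add: alt_sum_def)
next
  case (insert b B)
  show ?case
  proof (cases "b \<in> S")
    case True
    then show ?thesis
      using insert.prems by auto
  next
    case False
    \<comment> \<open>\<open>z\<close> carries out the substitution inside each \<open>y u\<close>;
      \<open>z'\<close> does so also for the vector that multiplies \<open>y b\<close>.\<close>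
    define z where "z u T = y u T -
      (\<Sum>w\<in>T. a w b * asgn w (T - {w}) * asgn b (T - {w}) * y u (insert b (T - {w})))" for u T
    define z' where "z' u T = z u T - a u b * z b T" for u T
    have card_swap: "card (insert b (T - {w})) = card T"
      if "T \<subseteq> U" "b \<notin> T" "w \<in> T" for T w
      using that finite_subset[OF that(1) insert.prems(1)] card_Suc_Diff1[of T w] by simp
    have z'_eq: "alt_sum z' T = alt_sum y T" if T: "T \<subseteq> U - {b}" "card T = Suc t" for T
    proof -
      have "finite T" "b \<notin> T"
        using T insert.prems(1) finite_subset by auto
      have "alt_sum y (insert b (T - {w})) = 0" if "w \<in> T" for w
        using that T insert.prems(2) card_swap[of T w] by (intro insert.prems(5)) auto
      then show ?thesis
        using alt_sum_substitute[OF \<open>finite T\<close> \<open>b \<notin> T\<close>, of y "\<lambda>w. a w b"]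
        by (simp add: z'_def[abs_def] z_def[abs_def])
    qed
    have z_lin: "z u T = (\<Sum>b'\<in>insert b B. a u b' * z b' T)"
      if "u \<in> U" "T \<subseteq> U - {b}" "card T = t" for u T
    proof -
      have swap: "y u (insert b (T - {w})) = (\<Sum>b'\<in>insert b B. a u b' * y b' (insert b (T - {w})))"
        if "w \<in> T" for w
        using that \<open>u \<in> U\<close> \<open>T \<subseteq> U - {b}\<close> \<open>card T = t\<close> insert.prems(2) card_swap[of T w]
        by (intro insert.prems(4)) auto
      have "y u T = (\<Sum>b'\<in>insert b B. a u b' * y b' T)"
        using that by (intro insert.prems(4)) auto
      moreover have "(\<Sum>w\<in>T. a w b * asgn w (T - {w}) * asgn b (T - {w}) * y u (insert b (T - {w})))
        = (\<Sum>b'\<in>insert b B. a u b' * (\<Sum>w\<in>T. a w b * asgn w (T - {w}) * asgn b (T - {w}) *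
            y b' (insert b (T - {w}))))"
        unfolding sum_distrib_left
        by (subst sum.swap) (simp only: swap sum_distrib_left mult_ac cong: sum.cong)
      ultimately show ?thesis
        by (simp add: z_def right_diff_distrib sum_subtractf del: sum.insert)
    qed
    have "alt_sum z' S = 0"
    proof (rule insert.IH[where U = "U - {b}"])
      show "finite (U - {b})" "B \<subseteq> U - {b}" "S \<subseteq> U - {b}" "card S = Suc t"
        using insert.prems insert.hyps False by auto
      show "a b' b'' = (if b' = b'' then 1 else 0)" if "b' \<in> B" "b'' \<in> B" for b' b''
        using insert.prems(3) that by simp
      show "alt_sum z' T = 0" if "T \<subseteq> U - {b}" "card T = Suc t" "T \<inter> B \<noteq> {}" for T
        unfolding z'_eq[OF that(1,2)] using that by (intro insert.prems(5)) auto
      show "z' u T = (\<Sum>b'\<in>B. a u b' * z' b' T)" if "u \<in> U - {b}" "T \<subseteq> U - {b}" "card T = t"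
        for u T
      proof -
        have "a b' b = 0" if "b' \<in> B" for b'
          using insert.prems(3)[of b' b] insert.hyps that by auto
        then have "(\<Sum>b'\<in>B. a u b' * z' b' T) = (\<Sum>b'\<in>B. a u b' * z b' T)"
          by (simp add: z'_def)
        then show ?thesis
          using z_lin[of u T] that insert.hyps by (simp add: z'_def)
      qed
    qed
    then show ?thesis
      using z'_eq[of S] insert.prems(6,7) False by (simp add: subset_Diff_insert)
  qed
qed

section \<open>Protocols with finitely many equiprobable keys\<close>

lemma one_less_card_field: "1 < CARD('a::{finite,field})"
proof -
  have "card {0, 1 :: 'a} \<le> CARD('a)"
    by (intro card_mono) auto
  then show ?thesis
    by simp
qed

text \<open>The view of a database is a function of its own query and of the messages, which are
  independent, so equal query laws give privacy. For recovery, the transcript must determine the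
  evaluations: \<open>rec\<close> compares two keys with the same queries and two message tuples
  with the same answers.\<close>

lemma ppc_achievableI:
  fixes qry :: "nat \<Rightarrow> 'k \<Rightarrow> nat \<Rightarrow> 'q" and keys :: "nat \<Rightarrow> 'k set" and QS :: "'q set"
    and ans :: "nat \<Rightarrow> 'q \<Rightarrow> (nat \<times> nat \<Rightarrow> 'a::{finite,field}) \<Rightarrow> 'a list"
  assumes "1 \<le> \<beta>" "0 < D" "finite QS"
    and keys: "\<And>v. v < \<mu> \<Longrightarrow> finite (keys v)" "\<And>v. v < \<mu> \<Longrightarrow> keys v \<noteq> {}"
    and qry: "\<And>v \<kappa> j. v < \<mu> \<Longrightarrow> \<kappa> \<in> keys v \<Longrightarrow> j < n \<Longrightarrow> qry v \<kappa> j \<in> QS"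
    and priv: "\<And>v v' j. v < \<mu> \<Longrightarrow> v' < \<mu> \<Longrightarrow> j < n \<Longrightarrow>
      map_pmf (\<lambda>\<kappa>. qry v \<kappa> j) (pmf_of_set (keys v)) =
      map_pmf (\<lambda>\<kappa>. qry v' \<kappa> j) (pmf_of_set (keys v'))"
    and len: "\<And>v \<kappa> C. v < \<mu> \<Longrightarrow> \<kappa> \<in> keys v \<Longrightarrow>
      (\<Sum>j<n. length (ans j (qry v \<kappa> j) (C j))) = D"
    and rec: "\<And>v \<kappa> \<kappa>' W W'. v < \<mu> \<Longrightarrow> \<kappa> \<in> keys v \<Longrightarrow> \<kappa>' \<in> keys v \<Longrightarrow>
      (\<And>j. j < n \<Longrightarrow> qry v \<kappa> j = qry v \<kappa>' j) \<Longrightarrow>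
      (\<And>j. j < n \<Longrightarrow> ans j (qry v \<kappa> j) (stored f \<beta> k \<alpha> \<gamma> W j) =
        ans j (qry v \<kappa> j) (stored f \<beta> k \<alpha> \<gamma> W' j)) \<Longrightarrow>
      function_evals \<beta> k (\<phi> v) W = function_evals \<beta> k (\<phi> v) W'"
  shows "ppc_achievable n k f \<mu> \<alpha> \<gamma> \<phi> (real (\<beta> * k) * H_min f \<mu> \<phi> / real D)"
proof -
  \<comment> \<open>Protocols use natural numbers as queries; \<open>QS\<close> contains every query
    sent to a database \<open>j < n\<close>, so \<open>from_nat_into\<close> undoes the
    numbering.\<close>
  define enc where "enc = to_nat_on QS"
  define Q where "Q v = map_pmf (\<lambda>\<kappa> j. enc (qry v \<kappa> j)) (pmf_of_set (keys v))" for v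
  define A where "A j q = ans j (from_nat_into QS q)" for j q
  have dec: "from_nat_into QS (enc x) = x" if "x \<in> QS" for x
    using that \<open>finite QS\<close> by (simp add: enc_def uncountable_infinite countable_finite)
  have supp: "\<exists>\<kappa>\<in>keys v. q = (\<lambda>j. enc (qry v \<kappa> j))" if "v < \<mu>" "q \<in> set_pmf (Q v)" for v q
    using that keys[OF that(1)] by (auto simp: Q_def)
  have "ppc_privacy n k f \<mu> \<beta> \<alpha> \<gamma> \<phi> Q A"
    unfolding ppc_privacy_def Let_def
  proof (intro allI impI)
    fix v v' j assume v: "v < \<mu>" "v' < \<mu>" "j < n"
    define h where "h = (\<lambda>(x, W). (x, A j x (stored f \<beta> k \<alpha> \<gamma> W j), all_function_evals \<beta> k \<mu> \<phi> W))"
    \<comment> \<open>The view depends on the query vector only through its component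
      \<open>j\<close>.\<close>
    have view: "map_pmf (\<lambda>(q, W). (q j, answer f \<beta> k \<alpha> \<gamma> A (q, W) j, all_function_evals \<beta> k \<mu> \<phi> W))
        (ppc_space f \<beta> k Q u) =
      map_pmf h (pair_pmf (map_pmf (\<lambda>q. q j) (Q u)) (message_pmf f \<beta> k))" for u
    proof -
      have "pair_pmf (map_pmf (\<lambda>q. q j) (Q u)) (message_pmf f \<beta> k) =
          map_pmf (\<lambda>(q, W). (q j, W)) (pair_pmf (Q u) (message_pmf f \<beta> k) :: (_ \<times> 'a messages) pmf)"
        by (simp add: pair_map_pmf1 apfst_def map_prod_def)
      then show ?thesis
        by (simp add: ppc_space_def map_pmf_comp h_def answer_def case_prod_unfold)
    qed
    have "map_pmf (\<lambda>q. q j) (Q u) = map_pmf enc (map_pmf (\<lambda>\<kappa>. qry u \<kappa> j) (pmf_of_set (keys u)))"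
      for u
      by (simp add: Q_def map_pmf_comp)
    then show "map_pmf (\<lambda>(q, W). (q j, answer f \<beta> k \<alpha> \<gamma> A (q, W) j, all_function_evals \<beta> k \<mu> \<phi> W))
        (ppc_space f \<beta> k Q v) =
      map_pmf (\<lambda>(q, W). (q j, answer f \<beta> k \<alpha> \<gamma> A (q, W) j, all_function_evals \<beta> k \<mu> \<phi> W))
        (ppc_space f \<beta> k Q v')"
      unfolding view using priv[OF v] by simp
  qed
  moreover have "ppc_recovery n k f \<mu> \<beta> \<alpha> \<gamma> \<phi> Q A"
    unfolding ppc_recovery_def
  proof (intro allI impI conditional_entropy_determined)
    show "1 < real CARD('a)"
      using one_less_card_field[where 'a = 'a] by simp
    fix v w w' assume v: "v < \<mu>" and w: "w \<in> set_pmf (ppc_space f \<beta> k Q v)"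
      "w' \<in> set_pmf (ppc_space f \<beta> k Q v)"
      and eq: "(case w of (q, W) \<Rightarrow> (map (answer f \<beta> k \<alpha> \<gamma> A (q, W)) [0..<n], map q [0..<n])) =
        (case w' of (q, W) \<Rightarrow> (map (answer f \<beta> k \<alpha> \<gamma> A (q, W)) [0..<n], map q [0..<n]))"
    obtain q W q' W' where [simp]: "w = (q, W)" "w' = (q', W')"
      by (metis surj_pair)
    obtain \<kappa> \<kappa>' where \<kappa>: "\<kappa> \<in> keys v" "q = (\<lambda>j. enc (qry v \<kappa> j))"
      "\<kappa>' \<in> keys v" "q' = (\<lambda>j. enc (qry v \<kappa>' j))"
      using w supp[OF v, of q] supp[OF v, of q'] by (auto simp: ppc_space_def)
    have qeq: "qry v \<kappa> j = qry v \<kappa>' j" if "j < n" for j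
    proof -
      have "q j = q' j"
        using eq that by simp
      then show ?thesis
        using dec qry[OF v _ that] \<kappa> by metis
    qed
    have "function_evals \<beta> k (\<phi> v) W = function_evals \<beta> k (\<phi> v) W'"
    proof (rule rec[OF v \<kappa>(1,3) qeq])
      fix j assume j: "j < n"
      then have "answer f \<beta> k \<alpha> \<gamma> A (q, W) j = answer f \<beta> k \<alpha> \<gamma> A (q', W') j"
        using eq by simp
      then show "ans j (qry v \<kappa> j) (stored f \<beta> k \<alpha> \<gamma> W j) =
          ans j (qry v \<kappa> j) (stored f \<beta> k \<alpha> \<gamma> W' j)"
        using \<kappa> qeq[OF j] qry[OF v _ j] by (simp add: answer_def A_def dec)
    qed auto
    then show "(case w of (q, W) \<Rightarrow> function_evals \<beta> k (\<phi> v) W) =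
        (case w' of (q, W) \<Rightarrow> function_evals \<beta> k (\<phi> v) W)"
      by simp
  qed
  moreover have "ppc_download n k f \<mu> \<beta> \<alpha> \<gamma> Q A D"
    unfolding ppc_download_def
  proof (intro allI impI ballI)
    fix v and w :: "(nat \<Rightarrow> nat) \<times> 'a messages"
    assume v: "v < \<mu>" and w: "w \<in> set_pmf (ppc_space f \<beta> k Q v)"
    obtain q W where [simp]: "w = (q, W)"
      by (metis surj_pair)
    obtain \<kappa> where \<kappa>: "\<kappa> \<in> keys v" "q = (\<lambda>j. enc (qry v \<kappa> j))"
      using w supp[OF v, of q] by (auto simp: ppc_space_def)
    have "(\<Sum>j<n. length (answer f \<beta> k \<alpha> \<gamma> A w j)) =
        (\<Sum>j<n. length (ans j (qry v \<kappa> j) (stored f \<beta> k \<alpha> \<gamma> W j)))"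
      using qry[OF v \<kappa>(1)] by (simp add: answer_def A_def dec \<kappa>(2))
    then show "(\<Sum>j<n. length (answer f \<beta> k \<alpha> \<gamma> A w j)) = D"
      using len[OF v \<kappa>(1)] by simp
  qed
  ultimately show ?thesis
    unfolding ppc_achievable_def using assms(1,2) by blast
qed

lemma function_evals_eqI:
  assumes "\<And>i c. i < \<beta> \<Longrightarrow> c < k \<Longrightarrow> eval_mpoly p (\<lambda>m. W (m, i, c)) = eval_mpoly p (\<lambda>m. W' (m, i, c))"
    and "1 \<le> k"
  shows "function_evals \<beta> k p W = function_evals \<beta> k p W'"
  unfolding function_evals_def message_symbol_def
  using assms by (auto intro!: assms(1) simp: less_mult_imp_div_less)

lemma stored_eq:
  assumes "m < f" "i < \<beta>"
  shows "stored f \<beta> k \<alpha> \<gamma> W j (m, i) = poly (lagrange_poly k \<gamma> (\<lambda>c. W (m, i, c))) (\<alpha> j)"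
  using assms by (simp add: stored_def lagrange_encode_def)

lemma candidate_functions_keys:
  assumes "candidate_functions g f \<mu> \<phi>" "v < \<mu>" "m \<in> Poly_Mapping.keys (\<phi> v)"
  shows "m \<in> monomials g f"
  using assms by (auto simp: candidate_functions_def monomials_def)

text \<open>One row (\<open>\<beta> = 1\<close>) suffices: the symbols stored at the first
  \<open>k\<close> databases are \<open>k\<close> values of polynomials of degree below
  \<open>k\<close> and hence determine all messages. The query is constant, so privacy is immediate,
  and \<open>f * k\<close> downloaded symbols serve \<open>k\<close> evaluations.\<close>

lemma ppc_achievable_trivial:
  fixes \<alpha> \<gamma> :: "nat \<Rightarrow> 'a::{finite,field}"
  assumes "1 \<le> k" "k \<le> n" "inj_on \<alpha> {..<n}" "inj_on \<gamma> {..<k}" "1 \<le> f"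
    and cand: "candidate_functions g f \<mu> \<phi>"
  shows "ppc_achievable n k f \<mu> \<alpha> \<gamma> \<phi> (1 / real f * H_min f \<mu> \<phi>)"
proof -
  define ans where "ans j (q::unit) C = (if j < k then map (\<lambda>m. C (m, 0)) [0..<f] else [])"
    for j q and C :: "nat \<times> nat \<Rightarrow> 'a"
  have "ppc_achievable n k f \<mu> \<alpha> \<gamma> \<phi> (real (1 * k) * H_min f \<mu> \<phi> / real (f * k))"
  proof (rule ppc_achievableI[where qry = "\<lambda>v \<kappa> j. ()" and keys = "\<lambda>_. {()}" and QS = "{()}"
        and ans = ans])
    show "0 < f * k"
      using assms by simp
    show "(\<Sum>j<n. length (ans j () (C j))) = f * k" for C
    proof -
      have "(\<Sum>j<n. length (ans j () (C j))) = (\<Sum>j\<in>{..<n} \<inter> {..<k}. f)"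
        by (subst sum.inter_restrict) (auto simp: ans_def intro!: sum.cong)
      moreover have "{..<n} \<inter> {..<k} = {..<k}"
        using assms(2) by auto
      ultimately show ?thesis
        by simp
    qed
    fix v W W'
    assume v: "v < \<mu>" and eq: "\<And>j. j < n \<Longrightarrow> ans j () (stored f 1 k \<alpha> \<gamma> W j) =
        ans j () (stored f 1 k \<alpha> \<gamma> W' j)"
    have W_eq: "W (m, 0, c) = W' (m, 0, c)" if "m < f" "c < k" for m c
    proof -
      let ?L = "\<lambda>W. lagrange_poly k \<gamma> (\<lambda>c. W (m, 0, c))"
      have "poly (?L W) (\<alpha> j) = poly (?L W') (\<alpha> j)" if "j < k" for j
        using eq[of j] that \<open>m < f\<close> assms(2) by (simp add: ans_def stored_eq)
      moreover have "degree (?L W - ?L W') < k"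
        using degree_lagrange_poly[OF assms(4,1)] degree_diff_le[of "?L W" "k - 1" "?L W'"] assms(1)
        by simp
      moreover have "inj_on \<alpha> {..<k}"
        using assms(2,3) by (auto intro: inj_on_subset)
      ultimately have "?L W - ?L W' = 0"
        by (intro poly_eq_0_if_many_zeros) auto
      then have "poly (?L W) (\<gamma> c) = poly (?L W') (\<gamma> c)"
        by simp
      then show ?thesis
        using that(2) by (simp add: poly_lagrange_poly[OF assms(4,1)])
    qed
    show "function_evals 1 k (\<phi> v) W = function_evals 1 k (\<phi> v) W'"
    proof (intro function_evals_eqI eval_mpoly_cong)
      fix i c m x assume "i < (1::nat)" "c < k" "m \<in> Poly_Mapping.keys (\<phi> v)"
        "x \<in> Poly_Mapping.keys m"
      then show "W (x, i, c) = W' (x, i, c)"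
        using candidate_functions_keys[OF cand v, of m] W_eq by (auto simp: monomials_def)
    qed fact
  qed auto
  moreover have "real (1 * k) * H_min f \<mu> \<phi> / real (f * k) = 1 / real f * H_min f \<mu> \<phi>"
    using assms(1,5) by simp
  ultimately show ?thesis
    by simp
qed

section \<open>Random labellings and the placement of rows\<close>

text \<open>The user's secret key: every row is attached to exactly one label, and every label
  receives a nonzero scalar. Fixing the values off \<open>L\<close> keeps the set of keys finite for
  finite \<open>L\<close> over a finite field.\<close>

definition labellings :: "nat \<Rightarrow> 'l set \<Rightarrow> ('l \<Rightarrow> nat \<times> 'a::field) set" where
  "labellings \<beta> L = {\<kappa> \<in> L \<rightarrow>\<^sub>E {..<\<beta>} \<times> (UNIV - {0}). bij_betw (\<lambda>l. fst (\<kappa> l)) L {..<\<beta>}}"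

text \<open>The query to one database: \<open>\<iota>\<close> names the label whose row fills a
  slot, and \<open>c\<close> is a deterministic correction of its scalar.\<close>

definition view :: "'o set \<Rightarrow> ('o \<Rightarrow> 'l) \<Rightarrow> ('o \<Rightarrow> 'a::field) \<Rightarrow> ('l \<Rightarrow> nat \<times> 'a) \<Rightarrow> 'o \<Rightarrow> nat \<times> 'a" where
  "view S \<iota> c \<kappa> = (\<lambda>s\<in>S. (fst (\<kappa> (\<iota> s)), c s * snd (\<kappa> (\<iota> s))))"

lemma labellingsD:
  assumes "\<kappa> \<in> labellings \<beta> L" "l \<in> L"
  shows "fst (\<kappa> l) < \<beta>" "snd (\<kappa> l) \<noteq> 0"
  using assms by (auto simp: labellings_def PiE_def Pi_def mem_Times_iff)

lemma finite_labellings: "finite L \<Longrightarrow> finite (labellings \<beta> L :: ('l \<Rightarrow> nat \<times> 'a::{finite,field}) set)"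
  unfolding labellings_def
  by (rule finite_subset[OF _ finite_PiE[of L "\<lambda>_. {..<\<beta>} \<times> (UNIV - {0})"]]) auto

lemma labellings_nonempty:
  assumes "finite L" "card L = \<beta>"
  shows "labellings \<beta> L \<noteq> {}"
proof -
  obtain h where h: "bij_betw h L {..<\<beta>}"
    using assms by (metis card_lessThan finite_lessThan finite_same_card_bij)
  have "(\<lambda>l\<in>L. (h l, 1)) \<in> labellings \<beta> L"
    using h bij_betwE[OF h] bij_betw_cong[of L h "\<lambda>l. fst ((\<lambda>l\<in>L. (h l, 1)) l)"]
    by (auto simp: labellings_def)
  then show ?thesis
    by auto
qed

text \<open>The inverse renaming together with division by \<open>t\<close> is the inverse map.
  Uniform keys therefore stay uniform under renaming and rescaling.\<close>

lemma relabelling_bij: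
  fixes L L' :: "'l set" and t :: "'l \<Rightarrow> 'a::field"
  assumes \<sigma>: "bij_betw \<sigma> L L'" and t: "\<And>l. l \<in> L \<Longrightarrow> t l \<noteq> 0"
  shows "bij_betw (\<lambda>\<kappa>. \<lambda>l\<in>L. (fst (\<kappa> (\<sigma> l)), t l * snd (\<kappa> (\<sigma> l)))) (labellings \<beta> L') (labellings \<beta> L)"
proof (rule bij_betw_byWitness)
  define \<tau> where "\<tau> = inv_into L \<sigma>"
  have \<tau>: "bij_betw \<tau> L' L"
    unfolding \<tau>_def using \<sigma> by (rule bij_betw_inv_into)
  have \<tau>\<sigma>: "\<tau> (\<sigma> l) = l" if "l \<in> L" for l
    using \<sigma> that by (simp add: \<tau>_def bij_betw_inv_into_left)
  have \<sigma>\<tau>: "\<sigma> (\<tau> l) = l" if "l \<in> L'" for l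
    using \<sigma> that by (simp add: \<tau>_def bij_betw_inv_into_right)
  note mem = bij_betwE[OF \<sigma>] bij_betwE[OF \<tau>]
  let ?F = "\<lambda>\<kappa> :: 'l \<Rightarrow> nat \<times> 'a. \<lambda>l\<in>L. (fst (\<kappa> (\<sigma> l)), t l * snd (\<kappa> (\<sigma> l)))"
  let ?G = "\<lambda>\<kappa> :: 'l \<Rightarrow> nat \<times> 'a. \<lambda>l\<in>L'. (fst (\<kappa> (\<tau> l)), snd (\<kappa> (\<tau> l)) / t (\<tau> l))"
  show "\<forall>\<kappa>\<in>labellings \<beta> L'. ?G (?F \<kappa>) = \<kappa>"
  proof (intro ballI ext)
    fix \<kappa> :: "'l \<Rightarrow> nat \<times> 'a" and l assume "\<kappa> \<in> labellings \<beta> L'"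
    then have "\<kappa> l = undefined" if "l \<notin> L'"
      using that by (auto simp: labellings_def PiE_def extensional_def)
    then show "?G (?F \<kappa>) l = \<kappa> l"
      using mem(2) \<sigma>\<tau>[of l] t[of "\<tau> l"] by (cases "l \<in> L'") auto
  qed
  show "\<forall>\<kappa>\<in>labellings \<beta> L. ?F (?G \<kappa>) = \<kappa>"
  proof (intro ballI ext)
    fix \<kappa> :: "'l \<Rightarrow> nat \<times> 'a" and l assume "\<kappa> \<in> labellings \<beta> L"
    then have "\<kappa> l = undefined" if "l \<notin> L"
      using that by (auto simp: labellings_def PiE_def extensional_def)
    then show "?F (?G \<kappa>) l = \<kappa> l"
      using mem(1) \<tau>\<sigma>[of l] t[of l] by (cases "l \<in> L") auto
  qed
  show "?F ` labellings \<beta> L' \<subseteq> labellings \<beta> L"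
  proof safe
    fix \<kappa> :: "'l \<Rightarrow> nat \<times> 'a" assume \<kappa>: "\<kappa> \<in> labellings \<beta> L'"
    have "bij_betw (\<lambda>l. fst (\<kappa> (\<sigma> l))) L {..<\<beta>}"
      using bij_betw_trans[OF \<sigma>, of "\<lambda>l. fst (\<kappa> l)"] \<kappa> by (simp add: labellings_def comp_def)
    then have "bij_betw (\<lambda>l. fst (?F \<kappa> l)) L {..<\<beta>}"
      by (rule iffD1[OF bij_betw_cong, rotated]) simp
    then show "?F \<kappa> \<in> labellings \<beta> L"
      using labellingsD[OF \<kappa>] mem t by (auto simp: labellings_def)
  qed
  show "?G ` labellings \<beta> L \<subseteq> labellings \<beta> L'"
  proof safe
    fix \<kappa> :: "'l \<Rightarrow> nat \<times> 'a" assume \<kappa>: "\<kappa> \<in> labellings \<beta> L"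
    have "bij_betw (\<lambda>l. fst (\<kappa> (\<tau> l))) L' {..<\<beta>}"
      using bij_betw_trans[OF \<tau>, of "\<lambda>l. fst (\<kappa> l)"] \<kappa> by (simp add: labellings_def comp_def)
    then have "bij_betw (\<lambda>l. fst (?G \<kappa> l)) L' {..<\<beta>}"
      by (rule iffD1[OF bij_betw_cong, rotated]) simp
    then show "?G \<kappa> \<in> labellings \<beta> L'"
      using labellingsD[OF \<kappa>] mem t by (auto simp: labellings_def)
  qed
qed

text \<open>The core of privacy: relabelling along a bijection that matches \<open>\<iota> s\<close>
  with \<open>\<iota>' s\<close>, with scalars \<open>c' s / c s\<close>, turns one view into the
  other and keeps keys uniform. The law of a query thus depends neither on how the slots are
  embedded nor on the corrections.\<close>

lemma map_view_labellings:
  fixes L L' :: "'l set" and c c' :: "'o \<Rightarrow> 'a::{finite,field}"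
  assumes fin: "finite L" "finite L'" and card: "card L = \<beta>" "card L' = \<beta>"
    and \<iota>: "inj_on \<iota> S" "\<iota> ` S \<subseteq> L" and \<iota>': "inj_on \<iota>' S" "\<iota>' ` S \<subseteq> L'"
    and c: "\<And>s. s \<in> S \<Longrightarrow> c s \<noteq> 0" "\<And>s. s \<in> S \<Longrightarrow> c' s \<noteq> 0"
  shows "map_pmf (view S \<iota> c) (pmf_of_set (labellings \<beta> L)) =
    map_pmf (view S \<iota>' c') (pmf_of_set (labellings \<beta> L'))"
proof -
  have "finite S"
    using \<iota> fin inj_on_finite by blast
  then have "card (L - \<iota> ` S) = card (L' - \<iota>' ` S)"
    using \<iota> \<iota>' card by (simp add: card_Diff_subset card_image)
  \<comment> \<open>The labels outside the two images are equally many, and the views do not show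
    them, so any bijection between them completes \<open>\<sigma>\<close>.\<close>
  then obtain g where g: "bij_betw g (L - \<iota> ` S) (L' - \<iota>' ` S)"
    using fin by (metis finite_Diff finite_same_card_bij)
  define \<sigma> where "\<sigma> l = (if l \<in> \<iota> ` S then \<iota>' (inv_into S \<iota> l) else g l)" for l
  define t where "t l = (if l \<in> \<iota> ` S then c' (inv_into S \<iota> l) / c (inv_into S \<iota> l) else 1)" for l
  have \<sigma>_\<iota>: "\<sigma> (\<iota> s) = \<iota>' s" and t_\<iota>: "t (\<iota> s) = c' s / c s" if "s \<in> S" for s
    using that \<iota>(1) by (auto simp: \<sigma>_def t_def)
  have "bij_betw \<sigma> (\<iota> ` S) (\<iota>' ` S)"
  proof -
    have "bij_betw (\<iota>' \<circ> inv_into S \<iota>) (\<iota> ` S) (\<iota>' ` S)"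
      using \<iota>(1) \<iota>'(1)
      by (intro bij_betw_trans[of "inv_into S \<iota>" _ S] bij_betw_inv_into inj_on_imp_bij_betw)
    then show ?thesis
      by (rule iffD1[OF bij_betw_cong, rotated]) (simp add: \<sigma>_def)
  qed
  moreover have "bij_betw \<sigma> (L - \<iota> ` S) (L' - \<iota>' ` S)"
    using g by (rule iffD1[OF bij_betw_cong, rotated]) (simp add: \<sigma>_def)
  ultimately have "bij_betw \<sigma> (\<iota> ` S \<union> (L - \<iota> ` S)) (\<iota>' ` S \<union> (L' - \<iota>' ` S))"
    by (rule bij_betw_combine) auto
  moreover have "\<iota> ` S \<union> (L - \<iota> ` S) = L" "\<iota>' ` S \<union> (L' - \<iota>' ` S) = L'"
    using \<iota>(2) \<iota>'(2) by auto
  ultimately have \<sigma>: "bij_betw \<sigma> L L'"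
    by simp
  define F where "F \<kappa> = (\<lambda>l\<in>L. (fst (\<kappa> (\<sigma> l)), t l * snd (\<kappa> (\<sigma> l))))"
    for \<kappa> :: "'l \<Rightarrow> nat \<times> 'a"
  have t_nz: "t l \<noteq> 0" for l
    using c \<iota>(1) by (auto simp: t_def)
  have "bij_betw F (labellings \<beta> L') (labellings \<beta> L)"
    unfolding F_def using relabelling_bij[OF \<sigma> t_nz] .
  then have "pmf_of_set (labellings \<beta> L) = map_pmf F (pmf_of_set (labellings \<beta> L'))"
    using finite_labellings[OF fin(2)] labellings_nonempty[OF fin(2) card(2)]
    by (intro map_pmf_of_set_bij_betw[symmetric]) auto
  moreover have "view S \<iota> c (F \<kappa>) = view S \<iota>' c' \<kappa>" for \<kappa>
  proof -
    have "F \<kappa> (\<iota> s) = (fst (\<kappa> (\<iota>' s)), c' s / c s * snd (\<kappa> (\<iota>' s)))" if "s \<in> S" for s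
      using \<iota>(2) that by (auto simp: F_def \<sigma>_\<iota> t_\<iota>)
    then show ?thesis
      using c by (auto simp: view_def)
  qed
  ultimately show ?thesis
    by (simp add: map_pmf_comp)
qed

section \<open>Slots, labels and their cyclic placement\<close>

locale rotation_scheme =
  fixes n K \<mu> :: nat
  assumes K_pos: "1 \<le> K" and K_less: "K < n" and \<mu>_pos: "1 \<le> \<mu>"
begin

text \<open>A slot (r, d, T) is the row attached to T in the query of order length r + 1 with number (r, d)
  to one database. A label (r, d, a, T) is the row attached to T in a group of order length r + 1,
  used at that order by the databases a, ..., a + K - 1 modulo n.\<close>

definition slots :: "(nat list \<times> nat list \<times> nat set) set" where
  "slots = {(r, d, T). set r \<subseteq> {..<n - K} \<and> set d \<subseteq> {..<K} \<and> length r + length d = \<mu> \<and>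
     d \<noteq> [] \<and> T \<subseteq> {..<\<mu>} \<and> card T = length r}"

definition labels :: "nat \<Rightarrow> (nat list \<times> nat list \<times> nat \<times> nat set) set" where
  "labels v = {(r, d, a, T). set r \<subseteq> {..<n - K} \<and> set d \<subseteq> {..<K} \<and>
     Suc (length r + length d) = \<mu> \<and> a < n \<and> T \<subseteq> {..<\<mu>} - {v} \<and> card T = length r}"

text \<open>The offset j - a modulo n tells on which side of a group database j lies: below K the slot
  asks for the desired function at the rows of the group, otherwise it reuses them as interference.\<close>

definition place :: "nat \<Rightarrow> nat \<Rightarrow> nat list \<times> nat list \<times> nat set \<Rightarrow>
    nat list \<times> nat list \<times> nat \<times> nat set" where
  "place v j = (\<lambda>(r, d, T). if v \<in> T then (tl r, d, (j + n - (K + hd r)) mod n, T - {v})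
     else (r, tl d, (j + n - hd d) mod n, T))"

text \<open>Compensates the change of the signs in a sum over S when v is removed from S.\<close>

definition twist :: "nat \<Rightarrow> nat list \<times> nat list \<times> nat set \<Rightarrow> 'a::field" where
  "twist v = (\<lambda>(r, d, T). if v \<in> T then asgn v (T - {v}) else 1)"

lemma twist_nonzero: "twist v s \<noteq> (0 :: 'a::field)"
  by (auto simp: twist_def split: prod.split)

text \<open>If \<open>v\<close> lies in \<open>T\<close> then \<open>length r = card T\<close> is
  positive, so the head removed by \<open>place\<close> exists; otherwise the head of the nonempty
  list \<open>d\<close> is removed. Either way the lengths add up to
  \<open>\<mu> - 1\<close>.\<close>

lemma place_in_labels:
  assumes "v < \<mu>" "s \<in> slots"
  shows "place v j s \<in> labels v"
proof -
  obtain r d T where [simp]: "s = (r, d, T)"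
    by (metis prod_cases3)
  have fin: "finite T"
    using assms(2) by (auto simp: slots_def intro: finite_subset)
  show ?thesis
  proof (cases "v \<in> T")
    case True
    then have "card T \<noteq> 0"
      using fin by auto
    then show ?thesis
      using assms True fin K_less
      by (cases r) (auto simp: slots_def labels_def place_def)
  next
    case False
    then show ?thesis
      using assms K_less by (cases d) (auto simp: slots_def labels_def place_def)
  qed
qed

lemma mod_diff_inj:
  assumes "(j + n - x) mod n = (j + n - y) mod n" "x < n" "y < n"
  shows "x = y"
proof -
  have le: "y \<le> x" if "x < n" "y < n" "(j + n - x) mod n = (j + n - y) mod n" for x y
  proof (rule ccontr)
    assume "\<not> y \<le> x"
    then have "n dvd (j + n - x) - (j + n - y)"
      using that mod_eq_dvd_iff_nat[of "j + n - y" "j + n - x" n] by simp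
    then have "n dvd y - x"
      using that by simp
    then show False
      using \<open>\<not> y \<le> x\<close> \<open>y < n\<close> dvd_imp_le[of n "y - x"] by simp
  qed
  show ?thesis
    using le[of x y] le[of y x] assms by simp
qed

text \<open>Injectivity means that no row fills two slots of a query, which
  \<open>map_view_labellings\<close> relies on. The label reveals the offset of database
  \<open>j\<close> in its group; comparing it with \<open>K\<close> tells whether \<open>v\<close>
  lies in \<open>T\<close>, and the offset is the removed list head, shifted by \<open>K\<close> if
  \<open>v\<close> is in \<open>T\<close>.\<close>

lemma inj_on_place:
  assumes "v < \<mu>"
  shows "inj_on (place v j) slots"
proof (rule inj_onI)
  fix s s' assume s: "s \<in> slots" "s' \<in> slots" "place v j s = place v j s'"
  obtain r d T r' d' T' where [simp]: "s = (r, d, T)" "s' = (r', d', T')"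
    by (metis prod_cases3)
  define x where "x r d T = (if v \<in> T then K + hd r else hd d)" for r d and T :: "nat set"
  have x_less: "x r d T < n" "x r d T < K \<longleftrightarrow> v \<notin> T" "v \<in> T \<Longrightarrow> r \<noteq> []" "d \<noteq> []"
    if "(r, d, T) \<in> slots" for r d T
  proof -
    have "finite T"
      using that by (auto simp: slots_def intro: finite_subset)
    show "v \<in> T \<Longrightarrow> r \<noteq> []"
      using that \<open>finite T\<close> by (auto simp: slots_def)
    then show "x r d T < n" "x r d T < K \<longleftrightarrow> v \<notin> T" "d \<noteq> []"
      using that K_less by (cases r; cases d; auto simp: slots_def x_def)+
  qed
  have "(j + n - x r d T) mod n = (j + n - x r' d' T') mod n"
    using s(3) by (auto simp: place_def x_def split: if_splits)
  have slots: "(r, d, T) \<in> slots" "(r', d', T') \<in> slots"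
    using s by simp_all
  have x_eq: "x r d T = x r' d' T'"
    using \<open>(j + n - x r d T) mod n = _\<close> x_less(1)[OF slots(1)] x_less(1)[OF slots(2)]
    by (rule mod_diff_inj)
  then have v_iff: "v \<in> T \<longleftrightarrow> v \<in> T'"
    using x_less(2)[OF slots(1)] x_less(2)[OF slots(2)] by simp
  show "s = s'"
  proof (cases "v \<in> T")
    case True
    then have "hd r = hd r'" "tl r = tl r'"
      using s(3) x_eq v_iff by (auto simp: x_def place_def)
    moreover have "r \<noteq> []" "r' \<noteq> []"
      using True v_iff x_less(3)[OF slots(1)] x_less(3)[OF slots(2)] by simp_all
    ultimately have "r = r'"
      by (simp add: list.expand)
    then show ?thesis
      using s(3) True v_iff by (auto simp: place_def)
  next
    case False
    then have "hd d = hd d'" "tl d = tl d'"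
      using s(3) x_eq v_iff by (auto simp: x_def place_def)
    then have "d = d'"
      using x_less(4)[OF slots(1)] x_less(4)[OF slots(2)] by (simp add: list.expand)
    then show ?thesis
      using s(3) False v_iff by (auto simp: place_def)
  qed
qed

lemma labels_UN: "labels v = (\<Union>t\<in>{..\<mu> - 1}. {r. set r \<subseteq> {..<n - K} \<and> length r = t} \<times>
    {d. set d \<subseteq> {..<K} \<and> length d = \<mu> - 1 - t} \<times> {..<n} \<times>
    {T. T \<subseteq> {..<\<mu>} - {v} \<and> card T = t})"
  using \<mu>_pos by (auto simp: labels_def)

lemma finite_labels: "finite (labels v)"
  unfolding labels_UN
  by (intro finite_UN_I finite_cartesian_product finite_lists_length_eq)
    (auto intro: finite_subset[OF _ finite_Pow_iff[THEN iffD2, of "{..<\<mu>} - {v}"]])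

text \<open>Sorting by the length of \<open>r\<close> gives the binomial expansion of
  \<open>((n - K) + K) ^ (\<mu> - 1)\<close>; a further factor \<open>n\<close> counts the starting
  points. The result is the same for all \<open>v\<close>, so one \<open>\<beta>\<close> fits every
  desired index.\<close>

lemma card_labels:
  assumes "v < \<mu>"
  shows "card (labels v) = n ^ \<mu>"
proof -
  have "card (labels v) = (\<Sum>t\<le>\<mu> - 1. card ({r. set r \<subseteq> {..<n - K} \<and> length r = t} \<times>
      {d. set d \<subseteq> {..<K} \<and> length d = \<mu> - 1 - t} \<times> {..<n} \<times>
      {T. T \<subseteq> {..<\<mu>} - {v} \<and> card T = t}))"
    unfolding labels_UN
    by (rule card_UN_disjoint)
      (auto intro!: finite_cartesian_product finite_lists_length_eq
        finite_subset[OF _ finite_Pow_iff[THEN iffD2, of "{..<\<mu>} - {v}"]])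
  also have "\<dots> = (\<Sum>t\<le>\<mu> - 1. n * (((\<mu> - 1) choose t) * (n - K) ^ t * K ^ (\<mu> - 1 - t)))"
    using assms by (intro sum.cong) (simp_all add: card_cartesian_product card_lists_length_eq n_subsets)
  also have "\<dots> = n * ((n - K) + K) ^ (\<mu> - 1)"
    unfolding binomial_ring by (simp add: sum_distrib_left)
  also have "\<dots> = n ^ \<mu>"
    using K_less \<mu>_pos by (simp flip: power_Suc)
  finally show ?thesis .
qed

end

section \<open>Download cost and decoding\<close>

lemma degree_asgn: "degree (asgn u T :: 'a::field poly) = 0"
  by (cases "even (card {w \<in> T. w < u})") (simp_all add: asgn_def)

lemma degree_alt_sum_less:
  fixes y :: "nat \<Rightarrow> nat set \<Rightarrow> 'a::field poly"
  assumes "\<And>u. u \<in> S \<Longrightarrow> degree (y u (S - {u})) < K" "0 < K"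
  shows "degree (alt_sum y S) < K"
  unfolding alt_sum_def
proof (rule degree_sum_less)
  fix u assume "u \<in> S"
  have "degree (asgn u (S - {u}) * y u (S - {u})) \<le> degree (y u (S - {u}))"
    using degree_mult_le[of "asgn u (S - {u})" "y u (S - {u})"] by (simp add: degree_asgn)
  then show "degree (asgn u (S - {u}) * y u (S - {u})) < K"
    using assms(1)[OF \<open>u \<in> S\<close>] by simp
qed fact

text \<open>Swapping the first two factors in the wedge product of \<open>e u\<close>,
  \<open>e v\<close> and \<open>e R\<close> changes the sign.\<close>

lemma asgn_exchange:
  assumes "finite R" "u \<notin> R" "v \<notin> R" "u \<noteq> v"
  shows "asgn u (insert v R) * asgn v R = (- asgn v (insert u R) * asgn u R :: 'a::comm_ring_1)"
  using assms by (auto simp: asgn_insert mult.commute)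

section \<open>Downloaded symbols and their number\<close>

context rotation_scheme
begin

text \<open>The sums of order \<open>length r + 1\<close>, at least 2, downloaded from each
  database. Sets avoiding \<open>B\<close> are left out because the other sums determine theirs.
  Order 1 is handled by \<open>symbol_index\<close>, where stored message symbols replace function
  values.\<close>

definition sum_index :: "nat set \<Rightarrow> (nat list \<times> nat list \<times> nat set) set" where
  "sum_index B = {(r, d, S). set r \<subseteq> {..<n - K} \<and> set d \<subseteq> {..<K} \<and> length r + length d = \<mu> \<and>
     r \<noteq> [] \<and> S \<subseteq> {..<\<mu>} \<and> card S = Suc (length r) \<and> S \<inter> B \<noteq> {}}"

definition symbol_index :: "nat \<Rightarrow> (nat list \<times> nat) set" where
  "symbol_index f = {d. set d \<subseteq> {..<K} \<and> length d = \<mu>} \<times> {..<f}"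

lemma card_symbol_index: "finite (symbol_index f)" "card (symbol_index f) = K ^ \<mu> * f"
  unfolding symbol_index_def by (simp_all add: finite_lists_length_eq card_cartesian_product card_lists_length_eq)

lemma sum_index_UN: "sum_index B = (\<Union>t\<in>{1..<\<mu>}. {r. set r \<subseteq> {..<n - K} \<and> length r = t} \<times>
    {d. set d \<subseteq> {..<K} \<and> length d = \<mu> - t} \<times>
    {S. S \<subseteq> {..<\<mu>} \<and> card S = Suc t \<and> S \<inter> B \<noteq> {}})"
proof (rule set_eqI)
  fix x :: "nat list \<times> nat list \<times> nat set"
  obtain r d S where [simp]: "x = (r, d, S)"
    by (metis prod_cases3)
  have "card S \<le> \<mu>" if "S \<subseteq> {..<\<mu>}"
    using card_mono[OF _ that] by simp
  then show "x \<in> sum_index B \<longleftrightarrow> x \<in> (\<Union>t\<in>{1..<\<mu>}. {r. set r \<subseteq> {..<n - K} \<and> length r = t} \<times>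
      {d. set d \<subseteq> {..<K} \<and> length d = \<mu> - t} \<times>
      {S. S \<subseteq> {..<\<mu>} \<and> card S = Suc t \<and> S \<inter> B \<noteq> {}})"
    by (auto simp: sum_index_def Suc_le_eq)
qed

lemma finite_subsets: "finite {S. S \<subseteq> {..<\<mu>} \<and> P S}"
  by (rule finite_subset[of _ "Pow {..<\<mu>}"]) auto

lemma card_meeting_subsets:
  assumes "B \<subseteq> {..<\<mu>}"
  shows "card {S. S \<subseteq> {..<\<mu>} \<and> card S = m \<and> S \<inter> B \<noteq> {}} = (\<mu> choose m) - ((\<mu> - card B) choose m)"
proof -
  have eq: "{S. S \<subseteq> {..<\<mu>} \<and> card S = m \<and> S \<inter> B \<noteq> {}} =
      {S. S \<subseteq> {..<\<mu>} \<and> card S = m} - {S. S \<subseteq> {..<\<mu>} - B \<and> card S = m}"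
    by auto
  have sub: "{S. S \<subseteq> {..<\<mu>} - B \<and> card S = m} \<subseteq> {S. S \<subseteq> {..<\<mu>} \<and> card S = m}"
    by auto
  have "card {S. S \<subseteq> {..<\<mu>} \<and> card S = m \<and> S \<inter> B \<noteq> {}} =
      card {S. S \<subseteq> {..<\<mu>} \<and> card S = m} - card {S. S \<subseteq> {..<\<mu>} - B \<and> card S = m}"
    unfolding eq by (rule card_Diff_subset[OF finite_subset[OF sub finite_subsets] sub])
  moreover have "card ({..<\<mu>} - B) = \<mu> - card B"
    using assms by (simp add: card_Diff_subset finite_subset[OF assms])
  ultimately show ?thesis
    by (simp add: n_subsets)
qed

lemma finite_sum_index: "finite (sum_index B)"
  unfolding sum_index_UN
  by (intro finite_UN_I finite_cartesian_product finite_lists_length_eq finite_subsets) auto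

lemma card_sum_index:
  assumes "B \<subseteq> {..<\<mu>}"
  shows "card (sum_index B) = (\<Sum>t\<in>{1..<\<mu>}. (n - K) ^ t * K ^ (\<mu> - t) *
    ((\<mu> choose Suc t) - ((\<mu> - card B) choose Suc t)))"
proof -
  have "card (sum_index B) = (\<Sum>t\<in>{1..<\<mu>}. card ({r. set r \<subseteq> {..<n - K} \<and> length r = t} \<times>
    {d. set d \<subseteq> {..<K} \<and> length d = \<mu> - t} \<times>
    {S. S \<subseteq> {..<\<mu>} \<and> card S = Suc t \<and> S \<inter> B \<noteq> {}}))"
    unfolding sum_index_UN
    by (rule card_UN_disjoint)
      (auto intro!: finite_cartesian_product finite_lists_length_eq finite_subsets)
  also have "\<dots> = (\<Sum>t\<in>{1..<\<mu>}. (n - K) ^ t * K ^ (\<mu> - t) *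
    ((\<mu> choose Suc t) - ((\<mu> - card B) choose Suc t)))"
    using assms
    by (intro sum.cong) (simp_all add: card_cartesian_product card_lists_length_eq card_meeting_subsets)
  finally show ?thesis .
qed

text \<open>The factor \<open>n - K\<close> raises each power to fit its binomial coefficient. What
  results is the expansion of \<open>n ^ p\<close> with \<open>n = (n - K) + K\<close>, without the
  term \<open>K ^ p\<close>, times the surplus powers of \<open>K\<close>.\<close>

lemma binomial_sum_shift:
  assumes "p \<le> \<mu>"
  shows "(real n - real K) * (\<Sum>t<\<mu>. (real n - real K) ^ t * real K ^ (\<mu> - t) * real (p choose Suc t)) =
    real K * (real K ^ (\<mu> - p) * (real n ^ p - real K ^ p))"
proof -
  let ?e = "real n - real K"
  have "real n ^ p = (\<Sum>s\<le>p. real (p choose s) * ?e ^ s * real K ^ (p - s))"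
    using binomial_ring[of ?e "real K" p] by simp
  also have "\<dots> = real K ^ p + (\<Sum>s<p. real (p choose Suc s) * ?e ^ Suc s * real K ^ (p - Suc s))"
    using sum.atMost_Suc_shift[of "\<lambda>s. real (p choose s) * ?e ^ s * real K ^ (p - s)" "p - 1"]
    by (cases p) (simp_all add: lessThan_Suc_atMost del: sum.atMost_Suc)
  finally have "real K * (real K ^ (\<mu> - p) * (real n ^ p - real K ^ p)) =
      (\<Sum>s<p. real K * (real K ^ (\<mu> - p) * (real (p choose Suc s) * ?e ^ Suc s * real K ^ (p - Suc s))))"
    by (simp add: sum_distrib_left)
  also have "\<dots> = (\<Sum>s<p. ?e * (?e ^ s * real K ^ (\<mu> - s) * real (p choose Suc s)))"
  proof (rule sum.cong)
    fix s assume "s \<in> {..<p}"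
    then have "\<mu> - s = Suc ((\<mu> - p) + (p - Suc s))"
      using assms by auto
    then have "real K ^ (\<mu> - s) = real K * (real K ^ (\<mu> - p) * real K ^ (p - Suc s))"
      by (simp only: power_add power_Suc)
    then show "real K * (real K ^ (\<mu> - p) * (real (p choose Suc s) * ?e ^ Suc s * real K ^ (p - Suc s))) =
        ?e * (?e ^ s * real K ^ (\<mu> - s) * real (p choose Suc s))"
      by simp
  qed simp
  also have "\<dots> = (\<Sum>s<\<mu>. ?e * (?e ^ s * real K ^ (\<mu> - s) * real (p choose Suc s)))"
    using assms by (intro sum.mono_neutral_left) auto
  finally show ?thesis
    by (simp add: sum_distrib_left)
qed

definition download :: "nat \<Rightarrow> nat set \<Rightarrow> nat" where
  "download f B = n * (card (symbol_index f) + card (sum_index B))"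

text \<open>Treating order 1 like the others would cost \<open>K ^ \<mu> * card B\<close> symbols
  per database; it is replaced by \<open>K ^ \<mu> * f\<close> stored symbols, which explains the
  term with \<open>card B - f\<close>. Two uses of \<open>binomial_sum_shift\<close>, for all
  subsets and for those avoiding \<open>B\<close>, give \<open>1 - \<rho> ^ card B\<close>.\<close>

lemma download_eq:
  assumes "B \<subseteq> {..<\<mu>}"
  defines "\<rho> \<equiv> real K / real n"
  shows "real (download f B) * (1 - \<rho>) = real n ^ \<mu> * real K *
    (1 - \<rho> ^ card B - (real (card B) - real f) * (1 - \<rho>) * \<rho> ^ (\<mu> - 1))"
proof -
  let ?e = "real n - real K"
  let ?r = "card B"
  have r: "?r \<le> \<mu>"
    using card_mono[OF _ assms(1)] by simp
  define s where "s p = (\<Sum>t<\<mu>. ?e ^ t * real K ^ (\<mu> - t) * real (p choose Suc t))" for p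
  have "real (card (sum_index B)) =
      (\<Sum>t\<in>{1..<\<mu>}. ?e ^ t * real K ^ (\<mu> - t) * (real (\<mu> choose Suc t) - real ((\<mu> - ?r) choose Suc t)))"
    unfolding card_sum_index[OF assms(1)] of_nat_sum of_nat_mult of_nat_power
    using K_less by (intro sum.cong) (simp_all add: of_nat_diff binomial_right_mono)
  also have "\<dots> = (\<Sum>t<\<mu>. ?e ^ t * real K ^ (\<mu> - t) *
      (real (\<mu> choose Suc t) - real ((\<mu> - ?r) choose Suc t))) - real K ^ \<mu> * real ?r"
  proof -
    have "{..<\<mu>} = insert 0 {1..<\<mu>}"
      using \<mu>_pos by auto
    then show ?thesis
      using r by (simp add: of_nat_diff)
  qed
  also have "\<dots> = s \<mu> - s (\<mu> - ?r) - real K ^ \<mu> * real ?r"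
    by (simp add: s_def right_diff_distrib sum_subtractf)
  finally have count: "real (card (sum_index B)) = s \<mu> - s (\<mu> - ?r) - real K ^ \<mu> * real ?r" .
  have "?e * real (card (sum_index B)) =
      ?e * s \<mu> - ?e * s (\<mu> - ?r) - ?e * (real K ^ \<mu> * real ?r)"
    unfolding count by (simp only: right_diff_distrib)
  also have "?e * s \<mu> = real K * (real n ^ \<mu> - real K ^ \<mu>)"
    using binomial_sum_shift[of \<mu>] by (simp add: s_def)
  also have "?e * s (\<mu> - ?r) = real K * (real K ^ ?r * (real n ^ (\<mu> - ?r) - real K ^ (\<mu> - ?r)))"
    using binomial_sum_shift[of "\<mu> - ?r"] r by (simp add: s_def)
  finally have "?e * real (card (sum_index B)) = real K * (real n ^ \<mu> - real K ^ ?r * real n ^ (\<mu> - ?r)) -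
      ?e * (real K ^ \<mu> * real ?r)"
    using r by (simp add: right_diff_distrib flip: power_add)
  then have main: "?e * (real K ^ \<mu> * real f + real (card (sum_index B))) =
      real K * (real n ^ \<mu> - real K ^ ?r * real n ^ (\<mu> - ?r)) - ?e * real K ^ \<mu> * (real ?r - real f)"
    by (simp add: algebra_simps)
  have n: "real n \<noteq> 0"
    using K_less by simp
  have e: "real n * (1 - \<rho>) = ?e"
    using n by (simp add: \<rho>_def field_simps)
  have "real (download f B) * (1 - \<rho>) = real n * (1 - \<rho>) * (real K ^ \<mu> * real f + real (card (sum_index B)))"
    by (simp add: download_def card_symbol_index)
  also have "\<dots> = real K * (real n ^ \<mu> - real K ^ ?r * real n ^ (\<mu> - ?r)) - ?e * real K ^ \<mu> * (real ?r - real f)"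
    unfolding e main ..
  also have "real K ^ ?r * real n ^ (\<mu> - ?r) = real n ^ \<mu> * \<rho> ^ ?r"
    using r n by (simp add: \<rho>_def power_divide power_diff)
  also have "?e * real K ^ \<mu> = real n ^ \<mu> * real K * (1 - \<rho>) * \<rho> ^ (\<mu> - 1)"
  proof -
    have "\<mu> = Suc (\<mu> - 1)"
      using \<mu>_pos by simp
    then have "real K ^ \<mu> = real K * real K ^ (\<mu> - 1)" "real n ^ \<mu> = real n * real n ^ (\<mu> - 1)"
      by (metis power_Suc)+
    then show ?thesis
      using n by (simp add: \<rho>_def power_divide field_simps)
  qed
  finally show ?thesis
    by (simp add: algebra_simps)
qed

section \<open>Decoding\<close>

text \<open>Prefixing \<open>d\<close> with the offset \<open>b\<close> gives the slot in which
  database \<open>a + b\<close> modulo \<open>n\<close> sees the row of this label; the offsets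
  below \<open>K\<close> yield \<open>K\<close> evaluation points for the group.\<close>

lemma place_upper:
  assumes "v \<notin> T" "a < n" "b < K"
  shows "place v ((a + b) mod n) (r, b # d, T) = (r, d, a, T)"
proof -
  have "((a + b) mod n + n - b) mod n = ((a + b) mod n + (n - b)) mod n"
    using assms K_less by simp
  also have "\<dots> = (a + b + (n - b)) mod n"
    by (simp add: mod_add_left_eq)
  also have "\<dots> = a"
    using assms K_less by simp
  finally show ?thesis
    using assms by (simp add: place_def)
qed

lemma inj_on_shift: "inj_on (\<lambda>b. (a + b) mod n) {..<K}"
proof (rule inj_onI)
  fix b b' assume "b \<in> {..<K}" "b' \<in> {..<K}" and eq: "(a + b) mod n = (a + b') mod n"
  then have less: "b < n" "b' < n"
    using K_less by auto
  have le: "x \<le> y" if "(a + x) mod n = (a + y) mod n" "x < n" for x y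
  proof (rule ccontr)
    assume "\<not> x \<le> y"
    then have "n dvd x - y"
      using mod_eq_dvd_iff_nat[of "a + y" "a + x" n] that(1) by simp
    then show False
      using \<open>\<not> x \<le> y\<close> that(2) dvd_imp_le[of n "x - y"] by simp
  qed
  show "b = b'"
    using le[of b b'] le[of b' b] eq less by simp
qed

text \<open>All sums are linear, so equal answers for two message tuples mean zero answers for the
  differences \<open>\<Delta> u i\<close>. \<open>Y\<close> is a summand at one database,
  \<open>X\<close> the polynomial behind it in a group. Sums over sets without \<open>v\<close>
  vanish as polynomials, hence also where they interfere; of a sum over \<open>insert v T\<close>
  only the term of \<open>v\<close> is left, and it vanishes at \<open>K\<close> points.\<close>

lemma decode:
  fixes \<Delta> :: "nat \<Rightarrow> nat \<Rightarrow> 'a::field poly"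
  assumes v: "v < \<mu>" and \<alpha>: "inj_on \<alpha> {..<n}" and \<kappa>: "\<kappa> \<in> labellings \<beta> (labels v)"
    and B: "B \<subseteq> {..<\<mu>}"
    and unit: "\<And>b b'. b \<in> B \<Longrightarrow> b' \<in> B \<Longrightarrow> a b b' = (if b = b' then 1 else 0)"
    and deg: "\<And>u i. u < \<mu> \<Longrightarrow> i < \<beta> \<Longrightarrow> degree (\<Delta> u i) < K"
    and lin: "\<And>u i. u < \<mu> \<Longrightarrow> i < \<beta> \<Longrightarrow> \<Delta> u i = (\<Sum>b\<in>B. smult (a u b) (\<Delta> b i))"
  defines "q \<equiv> \<lambda>j. view slots (place v j) (twist v) \<kappa>"
  assumes symbols: "\<And>j d u. j < n \<Longrightarrow> set d \<subseteq> {..<K} \<Longrightarrow> length d = \<mu> \<Longrightarrow> u < \<mu> \<Longrightarrow>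
      poly (\<Delta> u (fst (q j ([], d, {})))) (\<alpha> j) = 0"
    and sums: "\<And>j r d S. j < n \<Longrightarrow> (r, d, S) \<in> sum_index B \<Longrightarrow>
      alt_sum (\<lambda>u T. snd (q j (r, d, T)) * poly (\<Delta> u (fst (q j (r, d, T)))) (\<alpha> j)) S = 0"
    and i: "i < \<beta>"
  shows "\<Delta> v i = 0"
proof -
  define Y where "Y j r d u T = snd (q j (r, d, T)) * poly (\<Delta> u (fst (q j (r, d, T)))) (\<alpha> j)"
    for j r d u T
  define X where "X r d c u T = smult (snd (\<kappa> (r, d, c, T))) (\<Delta> u (fst (\<kappa> (r, d, c, T))))"
    for r d c u T
  have q_eq: "q j s = (fst (\<kappa> (place v j s)), twist v s * snd (\<kappa> (place v j s)))" if "s \<in> slots" for j s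
    using that by (simp add: q_def view_def)
  have row_less: "fst (q j s) < \<beta>" if "s \<in> slots" for j s
    using labellingsD(1)[OF \<kappa> place_in_labels[OF v that]] that by (simp add: q_eq)
  \<comment> \<open>Sums of order 1 have a single term and follow from the stored symbols; at higher
    orders the sums over sets avoiding \<open>B\<close> follow from the downloaded ones.\<close>
  have Y_zero: "alt_sum (Y j r d) S = 0"
    if j: "j < n" and rd: "set r \<subseteq> {..<n - K}" "set d \<subseteq> {..<K}" "length r + length d = \<mu>" "d \<noteq> []"
      and S: "S \<subseteq> {..<\<mu>}" "card S = Suc (length r)" for j r d S
  proof (cases "r = []")
    case True
    then obtain u where u: "S = {u}"
      using S by (auto simp: card_1_singleton_iff)
    then show ?thesis
      using symbols[OF j, of d u] rd S True by (simp add: alt_sum_def Y_def)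
  next
    case False
    show ?thesis
    proof (rule alt_sum_eq_0_if_meeting_spanning[where U = "{..<\<mu>}" and B = B and a = a and t = "length r"])
      show "finite B"
        using B by (rule finite_subset) simp
      \<comment> \<open>Row and scalar belong to the slot and do not depend on \<open>u\<close>, so
        the spanning relation passes to \<open>Y\<close>.\<close>
      show "Y j r d u T = (\<Sum>b\<in>B. a u b * Y j r d b T)"
        if "u \<in> {..<\<mu>}" "T \<subseteq> {..<\<mu>}" "card T = length r" for u T
      proof -
        have "(r, d, T) \<in> slots"
          using that rd by (simp add: slots_def)
        then show ?thesis
          unfolding Y_def using that
          by (subst lin[OF _ row_less]) (simp_all add: poly_sum sum_distrib_left mult_ac)
      qed
      show "alt_sum (Y j r d) S = 0" if "S \<subseteq> {..<\<mu>}" "card S = Suc (length r)" "S \<inter> B \<noteq> {}" for S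
        unfolding Y_def using that rd False by (intro sums[OF j]) (auto simp: sum_index_def)
    qed (use B unit S in auto)
  qed
  have Y_upper: "Y ((c + b) mod n) r (b # d) u T = poly (X r d c u T) (\<alpha> ((c + b) mod n))"
    if "(r, d, c, T) \<in> labels v" "b < K" for r d c u T b
  proof -
    have "(r, b # d, T) \<in> slots" "v \<notin> T" "c < n"
      using that by (auto simp: slots_def labels_def)
    then show ?thesis
      using that by (simp add: Y_def X_def q_eq place_upper twist_def)
  qed
  have zero_if: "p = 0" if "degree p < K" "\<And>b. b < K \<Longrightarrow> poly p (\<alpha> ((c + b) mod n)) = 0"
    for p and c :: nat
  proof (rule poly_eq_0_if_many_zeros[OF that(1)])
    have "inj_on (\<alpha> \<circ> (\<lambda>b. (c + b) mod n)) {..<K}"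
      using inj_on_shift K_less by (intro comp_inj_on inj_on_subset[OF \<alpha>]) auto
    then show "inj_on (\<lambda>b. \<alpha> ((c + b) mod n)) {..<K}"
      by (simp add: comp_def)
  qed (use that(2) in simp)
  \<comment> \<open>The \<open>K\<close> databases of the group exhibit \<open>K\<close> zeros of a
    polynomial of degree below \<open>K\<close>, so it vanishes at the other \<open>n - K\<close>
    databases too. This holds at all orders at once, and the decoding below uses no induction on the
    order.\<close>
  have X_zero: "alt_sum (X r d c) S = 0"
    if rd: "set r \<subseteq> {..<n - K}" "set d \<subseteq> {..<K}" "Suc (length r + length d) = \<mu>" "c < n"
      and S: "S \<subseteq> {..<\<mu>} - {v}" "card S = Suc (length r)" for r d c S
  proof (rule zero_if)
    have "finite S"
      using S by (auto intro: finite_subset)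
    have label: "(r, d, c, S - {u}) \<in> labels v" if "u \<in> S" for u
      using that rd S \<open>finite S\<close> by (auto simp: labels_def)
    show "degree (alt_sum (X r d c) S) < K"
    proof (rule degree_alt_sum_less)
      fix u assume "u \<in> S"
      then have "degree (\<Delta> u (fst (\<kappa> (r, d, c, S - {u})))) < K"
        using S labellingsD(1)[OF \<kappa> label] by (intro deg) auto
      then show "degree (X r d c u (S - {u})) < K"
        unfolding X_def by (rule order.strict_trans1[OF degree_smult_le])
    qed (use K_pos in simp)
    fix b assume "b < K"
    then have "alt_sum (\<lambda>u T. poly (X r d c u T) (\<alpha> ((c + b) mod n))) S = alt_sum (Y ((c + b) mod n) r (b # d)) S"
      using label by (intro alt_sum_cong) (simp add: Y_upper)
    also have "\<dots> = 0"
      using rd S \<open>b < K\<close> by (intro Y_zero) auto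
    finally show "poly (alt_sum (X r d c) S) (\<alpha> ((c + b) mod n)) = 0"
      by (simp add: poly_alt_sum)
  qed
  have decoded: "\<Delta> v (fst (\<kappa> (r, d, c, T))) = 0" if label: "(r, d, c, T) \<in> labels v" for r d c T
  proof (rule zero_if)
    show "degree (\<Delta> v (fst (\<kappa> (r, d, c, T)))) < K"
      using v labellingsD(1)[OF \<kappa> label] by (rule deg)
    have T: "T \<subseteq> {..<\<mu>} - {v}" "card T = length r" "finite T" "v \<notin> T"
      and rd: "set r \<subseteq> {..<n - K}" "set d \<subseteq> {..<K}" "Suc (length r + length d) = \<mu>" "c < n"
      using label by (auto simp: labels_def intro: finite_subset)
    fix b assume b: "b < K"
    define j where "j = (c + b) mod n"
    \<comment> \<open>For \<open>u\<close> in \<open>T\<close> the row is attached to a set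
      containing \<open>v\<close>, which \<open>place\<close> sends to a group of one order less;
      the sum of that group over \<open>T\<close> vanishes by \<open>X_zero\<close>.\<close>
    have interference: "(\<Sum>u\<in>T. asgn u (insert v (T - {u})) * Y j r (b # d) u (insert v (T - {u}))) = 0"
    proof (cases r)
      case Nil
      then show ?thesis
        using T by simp
    next
      case (Cons x r')
      \<comment> \<open>The start of the group in which database \<open>j\<close> has offset
        \<open>K + x\<close>, on the interference side.\<close>
      define c' where "c' = (j + n - (K + x)) mod n"
      have Y_lower: "Y j r (b # d) u (insert v (T - {u})) =
          asgn v (T - {u}) * poly (X r' (b # d) c' u (T - {u})) (\<alpha> j)" if "u \<in> T" for u
      proof -
        have "(r, b # d, insert v (T - {u})) \<in> slots"
          using rd T b v that card_Suc_Diff1[of T u] by (auto simp: slots_def)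
        then show ?thesis
          using T by (simp add: Y_def X_def q_eq Cons place_def c'_def twist_def)
      qed
      \<comment> \<open>\<open>twist\<close> supplies \<open>asgn v (T - {u})\<close>; exchanging
        \<open>u\<close> and \<open>v\<close> then leaves the common factor
        \<open>- asgn v T\<close> in front of an alternating sum over \<open>T\<close>.\<close>
      have "asgn u (insert v (T - {u})) * Y j r (b # d) u (insert v (T - {u})) =
          - asgn v T * (asgn u (T - {u}) * poly (X r' (b # d) c' u (T - {u})) (\<alpha> j))"
        if "u \<in> T" for u
      proof -
        have "asgn u (insert v (T - {u})) * asgn v (T - {u}) = (- asgn v T * asgn u (T - {u}) :: 'a)"
          using asgn_exchange[of "T - {u}" u v, where 'a = 'a] T that by (auto simp: insert_absorb)
        then show ?thesis
          by (simp add: Y_lower[OF that] flip: mult.assoc)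
      qed
      then have "(\<Sum>u\<in>T. asgn u (insert v (T - {u})) * Y j r (b # d) u (insert v (T - {u}))) =
          - asgn v T * alt_sum (\<lambda>u T. poly (X r' (b # d) c' u T) (\<alpha> j)) T"
        by (simp add: alt_sum_def sum_distrib_left)
      also have "\<dots> = - asgn v T * poly (alt_sum (X r' (b # d) c') T) (\<alpha> j)"
        by (simp add: poly_alt_sum)
      also have "alt_sum (X r' (b # d) c') T = 0"
        using rd T b K_less by (intro X_zero) (auto simp: Cons c'_def)
      finally show ?thesis
        by simp
    qed
    have "alt_sum (Y j r (b # d)) (insert v T) = 0"
      using rd T b v by (intro Y_zero) (auto simp: j_def)
    then have "asgn v T * Y j r (b # d) v T = 0"
      using interference T by (simp add: alt_sum_insert)
    then have "Y j r (b # d) v T = 0"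
      by (simp add: asgn_nonzero)
    then have "poly (X r d c v T) (\<alpha> j) = 0"
      using Y_upper[OF label b] by (simp add: j_def)
    then show "poly (\<Delta> v (fst (\<kappa> (r, d, c, T)))) (\<alpha> ((c + b) mod n)) = 0"
      using labellingsD(2)[OF \<kappa> label] by (simp add: X_def j_def)
  qed
  \<comment> \<open>A key attaches every row to some label, so every row is decoded.\<close>
  have "i \<in> (\<lambda>l. fst (\<kappa> l)) ` labels v"
    using \<kappa> i by (simp add: labellings_def bij_betw_def)
  then obtain l where l: "l \<in> labels v" "fst (\<kappa> l) = i"
    by blast
  obtain r d c T where "l = (r, d, c, T)"
    by (metis prod_cases4)
  then show ?thesis
    using decoded[of r d c T] l by simp
qed

end

section \<open>Achievability of the rate\<close>

lemma alt_sum_diff: "alt_sum (\<lambda>u T. y u T - y' u T) S = alt_sum y S - alt_sum y' S"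
  by (simp add: alt_sum_def right_diff_distrib sum_subtractf)

text \<open>Elimination gives a spanning subfamily with at most as many members as monomials;
  further candidates pad it to the exact size in the rate. Candidates outside \<open>B\<close> get
  coefficient 0 on the padding.\<close>

lemma spanning_candidates:
  fixes \<phi> :: "nat \<Rightarrow> 'a::field mpoly"
  assumes "candidate_functions g f \<mu> \<phi>"
  obtains B a where "B \<subseteq> {..<\<mu>}" "card B = min \<mu> (num_monoms g f)"
    "\<And>b b'. b \<in> B \<Longrightarrow> b' \<in> B \<Longrightarrow> a b b' = (if b = b' then 1 else 0)"
    "\<And>u m. u < \<mu> \<Longrightarrow> Poly_Mapping.lookup (\<phi> u) m = (\<Sum>b\<in>B. a u b * Poly_Mapping.lookup (\<phi> b) m)"
proof -
  let ?N = "monomials g f"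
  obtain B\<^sub>0 a\<^sub>0 where B0: "B\<^sub>0 \<subseteq> {..<\<mu>}" "card B\<^sub>0 \<le> card ?N"
    and a0: "\<forall>u\<in>{..<\<mu>}. \<forall>m\<in>?N. Poly_Mapping.lookup (\<phi> u) m =
      (\<Sum>b\<in>B\<^sub>0. a\<^sub>0 u b * Poly_Mapping.lookup (\<phi> b) m)"
    using spanning_subfamily[OF card_monomials(1)[of g f] finite_lessThan[of \<mu>], of "\<lambda>u. Poly_Mapping.lookup (\<phi> u)"]
    by blast
  have "card B\<^sub>0 \<le> min \<mu> (num_monoms g f)"
    using B0 card_monomials(2)[of g f] card_mono[OF finite_lessThan B0(1)] by simp
  then obtain B where B: "B\<^sub>0 \<subseteq> B" "B \<subseteq> {..<\<mu>}" "card B = min \<mu> (num_monoms g f)"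
    using exists_subset_between[of B\<^sub>0 "min \<mu> (num_monoms g f)" "{..<\<mu>}"] B0(1) by auto
  have fin: "finite B"
    using B(2) by (rule finite_subset) simp
  define a where "a u b = (if u \<in> B then if u = b then 1 else 0 else if b \<in> B\<^sub>0 then a\<^sub>0 u b else 0)"
    for u b
  have span: "Poly_Mapping.lookup (\<phi> u) m = (\<Sum>b\<in>B. a u b * Poly_Mapping.lookup (\<phi> b) m)"
    if "u < \<mu>" for u m
  proof (cases "u \<in> B")
    case True
    have "(\<Sum>b\<in>B. a u b * Poly_Mapping.lookup (\<phi> b) m) =
        (\<Sum>b\<in>B. if u = b then Poly_Mapping.lookup (\<phi> b) m else 0)"
      using True by (intro sum.cong) (auto simp: a_def)
    then show ?thesis
      using fin True by simp
  next
    case False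
    have "(\<Sum>b\<in>B. a u b * Poly_Mapping.lookup (\<phi> b) m) =
        (\<Sum>b\<in>B\<^sub>0. a\<^sub>0 u b * Poly_Mapping.lookup (\<phi> b) m)"
      using fin B(1) False by (intro sum.mono_neutral_cong_right) (auto simp: a_def)
    also have "\<dots> = Poly_Mapping.lookup (\<phi> u) m"
    proof (cases "m \<in> ?N")
      case True
      then show ?thesis
        using a0 that by simp
    next
      case False
      then have "Poly_Mapping.lookup (\<phi> b) m = 0" if "b < \<mu>" for b
        using candidate_functions_keys[OF assms that, of m] by (auto simp: in_keys_iff)
      then show ?thesis
        using that B0(1) by (auto simp: subset_iff intro!: sum.neutral)
    qed
    finally show ?thesis ..
  qed
  show ?thesis
    by (rule that[of B a]) (use B span in \<open>auto simp: a_def\<close>)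
qed

lemma smult_sum_right: "smult c (\<Sum>i\<in>A. p i) = (\<Sum>i\<in>A. smult c (p i))"
  by (induction A rule: infinite_finite_induct) (simp_all add: smult_add_right)

lemma compose_mpoly_superset:
  assumes "finite N" "Poly_Mapping.keys p \<subseteq> N"
  shows "compose_mpoly p L = (\<Sum>m\<in>N. smult (Poly_Mapping.lookup p m)
     (\<Prod>i\<in>Poly_Mapping.keys m. L i ^ Poly_Mapping.lookup m i))"
  unfolding compose_mpoly_def using assms
  by (intro sum.mono_neutral_left) (auto simp: in_keys_iff)

text \<open>Over a common set \<open>N\<close> of monomials, composition is visibly linear in the
  coefficients; this carries the spanning relation to the polynomials of every row.\<close>

lemma compose_mpoly_linear:
  assumes "finite B"
    and "\<And>m. Poly_Mapping.lookup p m = (\<Sum>b\<in>B. a b * Poly_Mapping.lookup (\<phi> b) m)"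
  shows "compose_mpoly p L = (\<Sum>b\<in>B. smult (a b) (compose_mpoly (\<phi> b) L))"
proof -
  define N where "N = Poly_Mapping.keys p \<union> (\<Union>b\<in>B. Poly_Mapping.keys (\<phi> b))"
  have N: "finite N" "Poly_Mapping.keys p \<subseteq> N" "\<And>b. b \<in> B \<Longrightarrow> Poly_Mapping.keys (\<phi> b) \<subseteq> N"
    using assms(1) by (auto simp: N_def)
  have "compose_mpoly p L = (\<Sum>m\<in>N. \<Sum>b\<in>B. smult (a b) (smult (Poly_Mapping.lookup (\<phi> b) m)
      (\<Prod>i\<in>Poly_Mapping.keys m. L i ^ Poly_Mapping.lookup m i)))"
    by (simp add: compose_mpoly_superset[OF N(1,2)] assms(2) smult_sum)
  also have "\<dots> = (\<Sum>b\<in>B. smult (a b) (compose_mpoly (\<phi> b) L))"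
    by (subst sum.swap) (simp add: compose_mpoly_superset[OF N(1,3)] smult_sum_right)
  finally show ?thesis .
qed

text \<open>One row per label fixes \<open>\<beta> = n ^ \<mu>\<close>. Privacy comes from
  \<open>map_view_labellings\<close>, recovery from \<open>decode\<close> for the differences of two
  message tuples, and the rate from \<open>download_eq\<close>.\<close>

lemma ppc_achievable_scheme:
  fixes \<alpha> \<gamma> :: "nat \<Rightarrow> 'a::{finite,field}" and \<phi> :: "nat \<Rightarrow> 'a mpoly"
  assumes k: "1 \<le> k" and \<alpha>: "inj_on \<alpha> {..<n}" and \<gamma>: "inj_on \<gamma> {..<k}"
    and f: "1 \<le> f" and \<mu>: "1 \<le> \<mu>" and cand: "candidate_functions g f \<mu> \<phi>"
    and less: "g * (k - 1) + 1 < n"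
  shows "ppc_achievable n k f \<mu> \<alpha> \<gamma> \<phi> (ppc_rate n k f g \<mu> (H_min f \<mu> \<phi>))"
proof -
  define K where "K = g * (k - 1) + 1"
  define r where "r = min \<mu> (num_monoms g f)"
  interpret rotation_scheme n K \<mu>
    using less \<mu> by unfold_locales (simp_all add: K_def)
  obtain B and a :: "nat \<Rightarrow> nat \<Rightarrow> 'a" where B: "B \<subseteq> {..<\<mu>}" "card B = r"
    and unit: "\<And>b b'. b \<in> B \<Longrightarrow> b' \<in> B \<Longrightarrow> a b b' = (if b = b' then 1 else 0)"
    and span: "\<And>u m. u < \<mu> \<Longrightarrow>
      Poly_Mapping.lookup (\<phi> u) m = (\<Sum>b\<in>B. a u b * Poly_Mapping.lookup (\<phi> b) m)"
    using spanning_candidates[OF cand] unfolding r_def by blast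
  have finB: "finite B"
    using B(1) by (rule finite_subset) simp
  define \<beta> where "\<beta> = n ^ \<mu>"
  obtain l\<^sub>1 where l1: "set l\<^sub>1 = symbol_index f" "distinct l\<^sub>1"
    using finite_distinct_list[OF card_symbol_index(1)] by blast
  obtain l\<^sub>2 where l2: "set l\<^sub>2 = sum_index B" "distinct l\<^sub>2"
    using finite_distinct_list[OF finite_sum_index] by blast
  define qry :: "nat \<Rightarrow> _ \<Rightarrow> nat \<Rightarrow> _ \<Rightarrow> nat \<times> 'a" where
    "qry v \<kappa> j = view slots (place v j) (twist v) \<kappa>" for v \<kappa> j
  define keys :: "nat \<Rightarrow> (_ \<Rightarrow> nat \<times> 'a) set" where "keys v = labellings \<beta> (labels v)" for v
  define evaluated where "evaluated q C u s = eval_mpoly (\<phi> u) (\<lambda>m. C (m, fst (q s)))"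
    for q :: "_ \<Rightarrow> nat \<times> 'a" and C u and s :: "nat list \<times> nat list \<times> nat set"
  \<comment> \<open>The lists \<open>l\<^sub>1\<close> and \<open>l\<^sub>2\<close> do not involve
    \<open>v\<close>; a database learns only a row number and a scalar for each slot.\<close>
  define ans :: "nat \<Rightarrow> _ \<Rightarrow> _ \<Rightarrow> 'a list" where
    "ans j q C = map (\<lambda>(d, m). C (m, fst (q ([], d, {})))) l\<^sub>1 @
      map (\<lambda>(r, d, S). alt_sum (\<lambda>u T. snd (q (r, d, T)) * evaluated q C u (r, d, T)) S) l\<^sub>2"
    for j q C
  have card_keys: "finite (labels v)" "card (labels v) = \<beta>" if "v < \<mu>" for v
    using that by (simp_all add: finite_labels card_labels \<beta>_def)
  \<comment> \<open>\<open>place 0 0\<close> embeds the slots in the finite set of labels for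
    desired index 0.\<close>
  have fin_slots: "finite slots"
    using \<mu>
    by (intro inj_on_finite[OF inj_on_place[of 0 0] _ finite_labels[of 0]] image_subsetI place_in_labels)
      simp_all
  have row_less: "fst (qry v \<kappa> j s) < \<beta>" if "v < \<mu>" "\<kappa> \<in> keys v" "s \<in> slots" for v \<kappa> j s
    using labellingsD(1)[OF that(2)[unfolded keys_def] place_in_labels[OF that(1,3)]] that(3)
    by (simp add: qry_def view_def)
  have download_pos: "0 < download f B"
    using K_less K_pos f by (simp add: download_def card_symbol_index)
  have "ppc_achievable n k f \<mu> \<alpha> \<gamma> \<phi> (real (\<beta> * k) * H_min f \<mu> \<phi> / real (download f B))"
  proof (rule ppc_achievableI[where qry = qry and keys = keys and ans = ans and
        QS = "slots \<rightarrow>\<^sub>E {..<\<beta>} \<times> UNIV"])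
    show "1 \<le> \<beta>"
      using K_less by (simp add: \<beta>_def)
    show "0 < download f B"
      by fact
    show "finite (slots \<rightarrow>\<^sub>E {..<\<beta>} \<times> (UNIV :: 'a set))"
      using fin_slots by (intro finite_PiE) auto
    show "finite (keys v)" "keys v \<noteq> {}" if "v < \<mu>" for v
      using card_keys[OF that] by (simp_all add: keys_def finite_labellings labellings_nonempty)
    show "qry v \<kappa> j \<in> slots \<rightarrow>\<^sub>E {..<\<beta>} \<times> UNIV" if "v < \<mu>" "\<kappa> \<in> keys v" for v \<kappa> j
      using row_less[OF that] by (auto simp: qry_def view_def mem_Times_iff)
    show "map_pmf (\<lambda>\<kappa>. qry v \<kappa> j) (pmf_of_set (keys v)) = map_pmf (\<lambda>\<kappa>. qry v' \<kappa> j) (pmf_of_set (keys v'))"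
      if "v < \<mu>" "v' < \<mu>" for v v' j
      unfolding qry_def keys_def using that
      by (intro map_view_labellings card_keys inj_on_place image_subsetI place_in_labels twist_nonzero)
    show "(\<Sum>j<n. length (ans j (qry v \<kappa> j) (C j))) = download f B" for v \<kappa> C
      using distinct_card[OF l1(2)] distinct_card[OF l2(2)] by (simp add: ans_def l1 l2 download_def)
    fix v \<kappa> W W'
    assume v: "v < \<mu>" and \<kappa>: "\<kappa> \<in> keys v"
      and eq: "\<And>j. j < n \<Longrightarrow> ans j (qry v \<kappa> j) (stored f \<beta> k \<alpha> \<gamma> W j) =
        ans j (qry v \<kappa> j) (stored f \<beta> k \<alpha> \<gamma> W' j)"
    let ?L = "\<lambda>W i m. lagrange_poly k \<gamma> (\<lambda>c. W (m, i, c))"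
    define \<Delta> where "\<Delta> u i = compose_mpoly (\<phi> u) (?L W i) - compose_mpoly (\<phi> u) (?L W' i)" for u i
    have poly_stored: "poly (compose_mpoly (\<phi> u) (?L W i)) (\<alpha> j) =
        eval_mpoly (\<phi> u) (\<lambda>m. stored f \<beta> k \<alpha> \<gamma> W j (m, i))"
      if "u < \<mu>" "i < \<beta>" for u i j and W :: "'a messages"
      unfolding poly_compose_mpoly using that candidate_functions_keys[OF cand]
      by (intro eval_mpoly_cong) (auto simp: stored_eq monomials_def subset_iff)
    have \<Delta>_zero: "\<Delta> v i = 0" if "i < \<beta>" for i
    proof (rule decode[OF v \<alpha> \<kappa>[unfolded keys_def] B(1) unit _ _ _ _ that, folded qry_def])
      fix u i assume u: "u < \<mu>" "i < \<beta>"
      have "degree (compose_mpoly (\<phi> u) (?L W i)) \<le> g * (k - 1)" for W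
        using candidate_functions_keys[OF cand u(1)] degree_lagrange_poly[OF \<gamma> k]
        by (intro degree_compose_mpoly) (auto simp: monomials_def)
      then show "degree (\<Delta> u i) < K"
        unfolding \<Delta>_def K_def by (intro le_imp_less_Suc[unfolded Suc_eq_plus1] degree_diff_le)
      show "\<Delta> u i = (\<Sum>b\<in>B. smult (a u b) (\<Delta> b i))"
        by (simp add: \<Delta>_def compose_mpoly_linear[OF finB span[OF u(1)]] smult_diff_right sum_subtractf)
    next
      fix j d u assume j: "j < n" and d: "set d \<subseteq> {..<K}" "length d = \<mu>" and u: "u < \<mu>"
      define i where "i = fst (qry v \<kappa> j ([], d, {}))"
      have "([], d, {}) \<in> slots"
        using d \<mu> by (auto simp: slots_def)
      then have i: "i < \<beta>"
        unfolding i_def by (rule row_less[OF v \<kappa>])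
      have "stored f \<beta> k \<alpha> \<gamma> W j (m, i) = stored f \<beta> k \<alpha> \<gamma> W' j (m, i)" if "m < f" for m
      proof -
        have "(d, m) \<in> set l\<^sub>1"
          using d that by (simp add: l1 symbol_index_def)
        then show ?thesis
          using eq[OF j] by (auto simp: ans_def i_def)
      qed
      then have "eval_mpoly (\<phi> u) (\<lambda>m. stored f \<beta> k \<alpha> \<gamma> W j (m, i)) =
          eval_mpoly (\<phi> u) (\<lambda>m. stored f \<beta> k \<alpha> \<gamma> W' j (m, i))"
        using candidate_functions_keys[OF cand u]
        by (intro eval_mpoly_cong) (auto simp: monomials_def subset_iff)
      then show "poly (\<Delta> u (fst (qry v \<kappa> j ([], d, {})))) (\<alpha> j) = 0"
        using u i by (simp add: \<Delta>_def poly_stored flip: i_def)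
    next
      fix j r d S assume j: "j < n" and S: "(r, d, S) \<in> sum_index B"
      let ?q = "qry v \<kappa> j"
      let ?Z = "\<lambda>W. alt_sum (\<lambda>u T. snd (?q (r, d, T)) * evaluated ?q (stored f \<beta> k \<alpha> \<gamma> W j) u (r, d, T)) S"
      have "(r, d, S) \<in> set l\<^sub>2"
        using S by (simp add: l2)
      then have "?Z W = ?Z W'"
        using eq[OF j] by (auto simp: ans_def)
      moreover have "alt_sum (\<lambda>u T. snd (?q (r, d, T)) * poly (\<Delta> u (fst (?q (r, d, T)))) (\<alpha> j)) S =
          ?Z W - ?Z W'"
        unfolding alt_sum_diff[symmetric]
      proof (rule alt_sum_cong)
        fix u assume u: "u \<in> S"
        have "finite S" "card S \<le> \<mu>" "u < \<mu>"
          using S u card_mono[of "{..<\<mu>}" S] by (auto simp: sum_index_def intro: finite_subset)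
        then have "(r, d, S - {u}) \<in> slots"
          using S u by (auto simp: sum_index_def slots_def)
        then have "fst (?q (r, d, S - {u})) < \<beta>"
          by (rule row_less[OF v \<kappa>])
        then show "snd (?q (r, d, S - {u})) * poly (\<Delta> u (fst (?q (r, d, S - {u})))) (\<alpha> j) =
            snd (?q (r, d, S - {u})) * evaluated ?q (stored f \<beta> k \<alpha> \<gamma> W j) u (r, d, S - {u}) -
            snd (?q (r, d, S - {u})) * evaluated ?q (stored f \<beta> k \<alpha> \<gamma> W' j) u (r, d, S - {u})"
          using \<open>u < \<mu>\<close> by (simp add: \<Delta>_def evaluated_def poly_stored right_diff_distrib)
      qed
      ultimately show "alt_sum (\<lambda>u T. snd (?q (r, d, T)) * poly (\<Delta> u (fst (?q (r, d, T)))) (\<alpha> j)) S = 0"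
        by simp
    qed
    show "function_evals \<beta> k (\<phi> v) W = function_evals \<beta> k (\<phi> v) W'"
    proof (rule function_evals_eqI[OF _ k])
      fix i c assume i: "i < \<beta>" "c < k"
      \<comment> \<open>Polynomials recovered from the points \<open>\<alpha> j\<close> are now
        compared at the \<open>\<gamma> c\<close>, where they take the values of the candidate on
        the messages.\<close>
      have "poly (compose_mpoly (\<phi> v) (?L W i)) (\<gamma> c) = poly (compose_mpoly (\<phi> v) (?L W' i)) (\<gamma> c)"
        using \<Delta>_zero[OF i(1)] by (simp add: \<Delta>_def)
      then show "eval_mpoly (\<phi> v) (\<lambda>m. W (m, i, c)) = eval_mpoly (\<phi> v) (\<lambda>m. W' (m, i, c))"
        by (simp add: poly_compose_mpoly poly_lagrange_poly[OF \<gamma> k i(2)])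
    qed
  qed
  moreover have "ppc_rate n k f g \<mu> (H_min f \<mu> \<phi>) = real (\<beta> * k) * H_min f \<mu> \<phi> / real (download f B)"
  proof -
    define \<rho> where "\<rho> = real K / real n"
    define P where "P = 1 - \<rho> ^ r - (real r - real f) * (1 - \<rho>) * \<rho> ^ (\<mu> - 1)"
    have eq: "real (download f B) * (1 - \<rho>) = real \<beta> * real K * P"
      using download_eq[OF B(1), of f] by (simp add: B(2) \<rho>_def P_def \<beta>_def)
    have pos: "1 - \<rho> \<noteq> 0" "real \<beta> \<noteq> 0" "real K \<noteq> 0" "real (download f B) \<noteq> 0"
      using K_less K_pos download_pos by (simp_all add: \<rho>_def \<beta>_def)
    \<comment> \<open>A positive download forces the denominator of the rate to be nonzero.\<close>
    have "P \<noteq> 0"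
      using eq pos by auto
    have "ppc_rate n k f g \<mu> h = (real k / real K * (1 - \<rho>) * h) / P" for h
      using K_less by (simp add: ppc_rate_def Let_def P_def \<rho>_def r_def K_def min_absorb1)
    moreover have "(real k / real K * (1 - \<rho>) * h) / P = real (\<beta> * k) * h / real (download f B)" for h
    proof -
      have "real k * (1 - \<rho>) * h * real (download f B) = real k * h * (real (download f B) * (1 - \<rho>))"
        by simp
      also have "\<dots> = real (\<beta> * k) * h * (real K * P)"
        unfolding eq by simp
      finally show ?thesis
        using \<open>P \<noteq> 0\<close> pos by (simp add: frac_eq_eq)
    qed
    ultimately show ?thesis
      by simp
  qed
  ultimately show ?thesis
    by simp
qed

theorem theorem5:
  fixes \<alpha> \<gamma> :: "nat \<Rightarrow> 'a::{finite,field}"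
    and \<phi> :: "nat \<Rightarrow> 'a mpoly"
    and n k f g \<mu> :: nat
  assumes "1 \<le> k" and "k \<le> n" and "n \<le> CARD('a)"
    and "inj_on \<alpha> {..<n}" and "inj_on \<gamma> {..<k}"
    and "1 \<le> f" and "1 \<le> g"
    and "f \<le> \<mu>" and "\<mu> \<le> num_polys CARD('a) g f"
    and "candidate_functions g f \<mu> \<phi>"
  shows "ppc_achievable n k f \<mu> \<alpha> \<gamma> \<phi> (ppc_rate n k f g \<mu> (H_min f \<mu> \<phi>))"
proof (cases "n \<le> g * (k - 1) + 1")
  case True
  then show ?thesis
    using ppc_achievable_trivial[of k n \<alpha> \<gamma> f g \<mu> \<phi>] assms by (simp add: ppc_rate_def)
next
  case False
  then show ?thesis
    using assms by (intro ppc_achievable_scheme) auto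
qed

end
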